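(* Let $G$ be a subgroup of the symmetric group $S_n$ and let $\chi$ be an irreducible character of $G$. Let $A=LL^*\in M_n(\mathbb{C})$ be a positive semi-definite matrix, where $L=(L_{ij})$ is a lower triangular matrix from a Cholesky decomposition of $A$. Then $$\bar{d}^G_\chi(A)=\det(A)+\delta_{\chi,1}\,|G|\prod_{i=1}^n |L_{i1}|^2+\sum_{\gamma\in \bar{\Delta}^*_G}\frac{1}{|G|}\sum_{g\in S_\gamma}\left|d^G_\chi(L^{\gamma} P_g)\right|^2,$$ where $\delta_{\chi,1}$ is the Kronecker delta, equal to $1$ if $\chi$ is the principal character of $G$ and $0$ otherwise.
   Context: Characters are characters of finite-dimensional complex representations; the principal character $1$ is constantly equal to $1$. For $G\le S_n$, a character $\chi$ of $G$ and $B=(B_{ij})\in M_n(\mathbb{C})$, put $d^G_\chi(B)=\sum_{g\in G}\chi(g)\prod_{i=1}^n B_{i\,g(i)}$ and $\bar d^G_\chi(B)=\frac{1}{\chi(e)}d^G_\chi(B)$, where $e$ is the identity. Let $\Gamma_{n,n}=\{\gamma=(\gamma_1,\dots,\gamma_n): \gamma_i\in\{1,\dots,n\}\}$. For $g\in S_n$ let $g\cdot\gamma=(\gamma_{g(1)},\dots,\gamma_{g(n)})$. For $\gamma\in\Gamma_{n,n}$ let $G_\gamma=\{g\in G: g\cdot\gamma=\gamma\}$ and let $[\gamma]=\{g\cdot \gamma: g\in G\}$ be the $G$-orbit of $\gamma$. Let $\Omega=\{\gamma\in\Gamma_{n,n}: \frac{1}{|G_\gamma|}\sum_{g\in G_\gamma}\chi(g)\neq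 0\}$. Let $\Delta_G$ be the set consisting of the lexicographically first element of each $G$-orbit in $\Gamma_{n,n}$, and let $\bar\Delta_G=\Delta_G\cap\Omega$. Let $\bar\Delta^*_G$ be the set of those $\gamma\in\bar\Delta_G$ that are neither a rearrangement of $(1,2,\dots,n)$ nor a constant sequence $(k,k,\dots,k)$, $1\le k\le n$. For $\gamma\in\Gamma_{n,n}$, $S_\gamma\subseteq G$ is a set of representatives of the cosets $G_\gamma g$ ($g\in G$) of $G_\gamma$ in $G$, so that $g\mapsto g\cdot\gamma$ is a bijection from $S_\gamma$ onto $[\gamma]$. For $\gamma\in\Gamma_{n,n}$, $L^\gamma$ is the $n\times n$ matrix with entries $(L^\gamma)_{ij}=L_{i\gamma_j}$. For $g\in S_n$, $P_g$ is the permutation matrix with $(P_g)_{ij}=\delta_{i\,g(j)}$, so $(L^\gamma P_g)_{ij}=L_{i\,\gamma_{g(j)}}$.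
   Formalization: The formal theorem assumes n ≥ 2; for n = 1 the printed formula fails, since the left side is |L_11|^2 while the right side is det(A) + |L_11|^2 = 2|L_11|^2, which differ unless L_11 = 0. *)

theory Defs
  imports
    "HOL-Combinatorics.Permutations"
    "HOL-Algebra.Coset"
    "Jordan_Normal_Form.Determinant"
    "Jordan_Normal_Form.Schur_Decomposition"
    "Jordan_Normal_Form.VS_Connect"
begin

(* The index set {1,...,n} is rendered as {..<n}, matching the 0-based indexing of matrices;
   in particular the first column of a matrix has index 0. *)

(* Permutations multiply by composition, (g h)(i) = g (h i). *)
definition perm_group :: "nat \<Rightarrow> (nat \<Rightarrow> nat) monoid" where
  "perm_group n = \<lparr>carrier = {p. p permutes {..<n}}, monoid.mult = (\<circ>), one = id\<rparr>"

abbreviation perm_subgroup :: "nat \<Rightarrow> (nat \<Rightarrow> nat) set \<Rightarrow> (nat \<Rightarrow> nat) monoid" where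
  "perm_subgroup n G \<equiv> (perm_group n)\<lparr>carrier := G\<rparr>"


section \<open>Representations and characters\<close>

(* units_of (ring_mat ...) is GL(m, C). *)
definition representation ::
  "('g, 'x) monoid_scheme \<Rightarrow> nat \<Rightarrow> ('g \<Rightarrow> complex mat) \<Rightarrow> bool" where
  "representation H m \<rho> \<longleftrightarrow> \<rho> \<in> hom H (units_of (ring_mat TYPE(complex) m ()))"

definition irreducible_representation ::
  "('g, 'x) monoid_scheme \<Rightarrow> nat \<Rightarrow> ('g \<Rightarrow> complex mat) \<Rightarrow> bool" where
  "irreducible_representation H m \<rho> \<longleftrightarrow>
     representation H m \<rho> \<and> m > 0 \<and>
     (\<forall>W. VectorSpace.subspace class_ring W (module_vec TYPE(complex) m) \<and>
          (\<forall>g\<in>carrier H. \<forall>w\<in>W. \<rho> g *\<^sub>v w \<in> W)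
        \<longrightarrow> W = {0\<^sub>v m} \<or> W = carrier_vec m)"

definition mat_trace :: "complex mat \<Rightarrow> complex" where
  "mat_trace A = (\<Sum>i<dim_row A. A $$ (i, i))"

(* Only the values of chi on the group matter. *)
definition irreducible_character ::
  "('g, 'x) monoid_scheme \<Rightarrow> ('g \<Rightarrow> complex) \<Rightarrow> bool" where
  "irreducible_character H \<chi> \<longleftrightarrow>
     (\<exists>m \<rho>. irreducible_representation H m \<rho> \<and> (\<forall>g\<in>carrier H. \<chi> g = mat_trace (\<rho> g)))"

definition principal_character :: "('g, 'x) monoid_scheme \<Rightarrow> ('g \<Rightarrow> complex) \<Rightarrow> bool" where
  "principal_character H \<chi> \<longleftrightarrow> (\<forall>g\<in>carrier H. \<chi> g = 1)"


section \<open>Matrices\<close>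

(* The order on complex numbers is the partial one: 0 <= z means that z is real and nonnegative. *)
definition positive_semidefinite :: "nat \<Rightarrow> complex mat \<Rightarrow> bool" where
  "positive_semidefinite n A \<longleftrightarrow>
     A \<in> carrier_mat n n \<and> mat_adjoint A = A \<and>
     (\<forall>v\<in>carrier_vec n. 0 \<le> (A *\<^sub>v v) \<bullet>c v)"

(* No sign condition is imposed on the diagonal of L. *)
definition cholesky_decomposition :: "nat \<Rightarrow> complex mat \<Rightarrow> complex mat \<Rightarrow> bool" where
  "cholesky_decomposition n A L \<longleftrightarrow>
     L \<in> carrier_mat n n \<and> (\<forall>i<n. \<forall>j<n. i < j \<longrightarrow> L $$ (i, j) = 0) \<and>
     A = L * mat_adjoint L"

definition gen_mat_fun ::
  "nat \<Rightarrow> (nat \<Rightarrow> nat) set \<Rightarrow> ((nat \<Rightarrow> nat) \<Rightarrow> complex) \<Rightarrow> complex mat \<Rightarrow> complex" where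
  "gen_mat_fun n G \<chi> B = (\<Sum>g\<in>G. \<chi> g * (\<Prod>i<n. B $$ (i, g i)))"

definition normalized_gen_mat_fun ::
  "nat \<Rightarrow> (nat \<Rightarrow> nat) set \<Rightarrow> ((nat \<Rightarrow> nat) \<Rightarrow> complex) \<Rightarrow> complex mat \<Rightarrow> complex" where
  "normalized_gen_mat_fun n G \<chi> B = 1 / \<chi> id * gen_mat_fun n G \<chi> B"

definition select_cols :: "nat \<Rightarrow> complex mat \<Rightarrow> nat list \<Rightarrow> complex mat" where
  "select_cols n L \<gamma> = mat n n (\<lambda>(i, j). L $$ (i, \<gamma> ! j))"

definition perm_matrix :: "nat \<Rightarrow> (nat \<Rightarrow> nat) \<Rightarrow> complex mat" where
  "perm_matrix n g = mat n n (\<lambda>(i, j). if i = g j then 1 else 0)"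


section \<open>Sequences and the action of the group\<close>

(* The action of g on a sequence gamma of length n is permute_list g gamma, whose i-th entry
   is gamma ! (g i). *)

definition Gamma :: "nat \<Rightarrow> nat list set" where
  "Gamma n = {\<gamma>. length \<gamma> = n \<and> set \<gamma> \<subseteq> {..<n}}"

definition seq_stabilizer :: "(nat \<Rightarrow> nat) set \<Rightarrow> nat list \<Rightarrow> (nat \<Rightarrow> nat) set" where
  "seq_stabilizer G \<gamma> = {g\<in>G. permute_list g \<gamma> = \<gamma>}"

definition seq_orbit :: "(nat \<Rightarrow> nat) set \<Rightarrow> nat list \<Rightarrow> nat list set" where
  "seq_orbit G \<gamma> = (\<lambda>g. permute_list g \<gamma>) ` G"

definition Omega ::
  "nat \<Rightarrow> (nat \<Rightarrow> nat) set \<Rightarrow> ((nat \<Rightarrow> nat) \<Rightarrow> complex) \<Rightarrow> nat list set" where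
  "Omega n G \<chi> =
     {\<gamma>\<in>Gamma n. 1 / of_nat (card (seq_stabilizer G \<gamma>)) * (\<Sum>g\<in>seq_stabilizer G \<gamma>. \<chi> g) \<noteq> 0}"

definition Delta :: "nat \<Rightarrow> (nat \<Rightarrow> nat) set \<Rightarrow> nat list set" where
  "Delta n G =
     {\<gamma>\<in>Gamma n. \<forall>\<delta>\<in>seq_orbit G \<gamma>. \<delta> = \<gamma> \<or> (\<gamma>, \<delta>) \<in> lex less_than}"

definition Delta_bar ::
  "nat \<Rightarrow> (nat \<Rightarrow> nat) set \<Rightarrow> ((nat \<Rightarrow> nat) \<Rightarrow> complex) \<Rightarrow> nat list set" where
  "Delta_bar n G \<chi> = Delta n G \<inter> Omega n G \<chi>"

definition Delta_bar_star ::
  "nat \<Rightarrow> (nat \<Rightarrow> nat) set \<Rightarrow> ((nat \<Rightarrow> nat) \<Rightarrow> complex) \<Rightarrow> nat list set" where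
  "Delta_bar_star n G \<chi> =
     {\<gamma>\<in>Delta_bar n G \<chi>. mset \<gamma> \<noteq> mset [0..<n] \<and> (\<forall>k<n. \<gamma> \<noteq> replicate n k)}"

(* The cosets are those of the form {h o g | h in G_gamma}. *)
definition stabilizer_coset_reps ::
  "nat \<Rightarrow> (nat \<Rightarrow> nat) set \<Rightarrow> nat list \<Rightarrow> (nat \<Rightarrow> nat) set \<Rightarrow> bool" where
  "stabilizer_coset_reps n G \<gamma> S \<longleftrightarrow>
     S \<subseteq> G \<and>
     (\<forall>C\<in>rcosets\<^bsub>perm_subgroup n G\<^esub> (seq_stabilizer G \<gamma>). \<exists>!g. g \<in> S \<inter> C)"

end

theory Submission
  imports Defs "Jordan_Normal_Form.Spectral_Radius" "HOL-Algebra.Multiplicative_Group"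
begin

text \<open>
  Let $x_\gamma = \prod_i L_{i\gamma_i}$ and let $T x$ be the symmetrization
  $(Tx)_\gamma = \sum_{h\in G} \chi(h) x_{h\cdot\gamma}$. Expanding $A = LL^*$ gives
  $d^G_\chi(A) = \sum_\gamma x_\gamma \overline{(Tx)_\gamma}$, and
  $d^G_\chi(L^\gamma P_g) = (Tx)_{g\cdot\gamma}$. By Schur orthogonality
  $\chi * \chi = \frac{|G|}{\chi(e)} \chi$, so $T$ is a multiple of an orthogonal projection and
  $\bar d^G_\chi(A) = \frac{1}{|G|} \sum_\gamma |(Tx)_\gamma|^2$. In this sum the rearrangements of
  $(1,\dots,n)$ contribute $\det A$ and the constant sequences the term with $\delta_{\chi,1}$,
  because $L$ is lower triangular; $Tx$ vanishes on the orbits outside $\Omega$.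
\<close>

section \<open>Traces of matrices of finite order\<close>

text \<open>The constants come from self-adjointness. Since \<open>\<chi>\<close> takes conjugate
  values at inverse elements, T is self-adjoint and the squared norm of T x is |G|/\<chi>(e) times
  the pairing of x with T x; the factor 1/\<chi>(e) in the normalized function therefore cancels.
  The conjugation rule is usually read off a unitary model of the representation. Here the
  representation is an arbitrary one, and the rule comes from the finite order of its matrices,
  whose eigenvalues are roots of unity. The map (g, \<gamma>) \<mapsto> g \<cdot> \<gamma> is a
  right action, which explains the inverses in the formulas for T and the side on which the
  stabilizer cosets are taken. On the rearrangements and the constant sequences T x is known
  explicitly, so these classes are summed directly; only the remaining sequences are grouped into
  orbits.\<close>

lemma mat_trace_mult_comm:
  assumes "A \<in> carrier_mat n k" "B \<in> carrier_mat k n"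
  shows "mat_trace (A * B) = mat_trace (B * A)"
proof -
  have "mat_trace (A * B) = (\<Sum>i<n. \<Sum>j<k. A $$ (i, j) * B $$ (j, i))"
    using assms by (auto simp: mat_trace_def scalar_prod_def atLeast0LessThan intro!: sum.cong)
  also have "\<dots> = (\<Sum>j<k. \<Sum>i<n. B $$ (j, i) * A $$ (i, j))"
    by (subst sum.swap) (simp add: mult.commute)
  also have "\<dots> = mat_trace (B * A)"
    using assms by (auto simp: mat_trace_def scalar_prod_def atLeast0LessThan intro!: sum.cong)
  finally show ?thesis .
qed

lemma mat_trace_similar:
  assumes "similar_mat A B"
  shows "mat_trace A = mat_trace B"
proof -
  obtain n P Q where *: "A \<in> carrier_mat n n" "B \<in> carrier_mat n n" "P \<in> carrier_mat n n"
    "Q \<in> carrier_mat n n" "Q * P = 1\<^sub>m n" "A = P * B * Q"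
    using similar_matD[OF assms] by auto
  then have "mat_trace A = mat_trace (Q * (P * B))"
    using mat_trace_mult_comm[of "P * B" n n Q] by auto
  also have "Q * (P * B) = B"
    using * assoc_mult_mat[of Q n n P n B n] left_mult_one_mat[of B n n] by simp
  finally show ?thesis .
qed

lemma upper_triangular_mult_diag:
  fixes A B :: "'a::semiring_0 mat"
  assumes "A \<in> carrier_mat n n" "B \<in> carrier_mat n n"
    and "upper_triangular A" "upper_triangular B"
  shows "upper_triangular (A * B)" "i < n \<Longrightarrow> (A * B) $$ (i, i) = A $$ (i, i) * B $$ (i, i)"
proof -
  \<comment> \<open>A nonzero term requires i \<le> k \<le> j, so for j \<le> i only k = i = j
    survives. One fact thus yields both conclusions.\<close>
  have zero: "A $$ (i, k) * B $$ (k, j) = 0" if "i < n" "j < n" "k < n" "j \<le> i" "k \<noteq> i \<or> j < i" for i j k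
  proof (cases "k < i")
    case True
    then show ?thesis using assms that upper_triangularD[of A k i] by auto
  next
    case False
    then show ?thesis using assms that upper_triangularD[of B j k] by auto
  qed
  show "upper_triangular (A * B)"
    using assms(1,2) by (auto simp: scalar_prod_def zero intro!: sum.neutral)
  show "(A * B) $$ (i, i) = A $$ (i, i) * B $$ (i, i)" if "i < n"
  proof -
    have "(A * B) $$ (i, i) = (\<Sum>k<n. A $$ (i, k) * B $$ (k, i))"
      using assms(1,2) that by (simp add: scalar_prod_def atLeast0LessThan)
    also have "\<dots> = (\<Sum>k<n. if k = i then A $$ (i, i) * B $$ (i, i) else 0)"
      using zero[of i i] that by (intro sum.cong) auto
    finally show ?thesis using that by simp
  qed
qed

lemma upper_triangular_pow_diag:
  fixes A :: "'a::semiring_1 mat"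
  assumes "A \<in> carrier_mat n n" "upper_triangular A"
  shows "upper_triangular (A ^\<^sub>m k)" "i < n \<Longrightarrow> (A ^\<^sub>m k) $$ (i, i) = (A $$ (i, i)) ^ k"
proof -
  have "upper_triangular (A ^\<^sub>m k) \<and> (\<forall>i<n. (A ^\<^sub>m k) $$ (i, i) = (A $$ (i, i)) ^ k)"
  proof (induction k)
    case 0
    then show ?case using assms by auto
  next
    case (Suc k)
    then show ?case
      using upper_triangular_mult_diag[of "A ^\<^sub>m k" n A] assms
      by (auto simp: power_commutes)
  qed
  then show "upper_triangular (A ^\<^sub>m k)" "i < n \<Longrightarrow> (A ^\<^sub>m k) $$ (i, i) = (A $$ (i, i)) ^ k"
    by auto
qed

lemma root_of_unity_power_eq_cnj:
  assumes "z ^ Suc k = (1::complex)"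
  shows "z ^ k = cnj z"
proof -
  have "cmod z ^ Suc k = 1"
    using assms by (metis norm_one norm_power)
  then have "cmod z = 1"
    using power_eq_imp_eq_base[of "cmod z" "Suc k" 1] by simp
  then have "z * cnj z = 1"
    using complex_norm_square[of z] by simp
  then show ?thesis
    using assms by (metis mult.assoc mult.commute mult_1 power_Suc)
qed

text \<open>Here \<open>A ^\<^sub>m k\<close> is the inverse of A. After triangularization the
  diagonal entries are roots of unity, for which inversion is conjugation. This takes the place of
  an invariant inner product.\<close>

lemma mat_trace_finite_order:
  assumes A: "A \<in> carrier_mat n n" and ord: "A ^\<^sub>m Suc k = 1\<^sub>m n"
  shows "mat_trace (A ^\<^sub>m k) = cnj (mat_trace A)"
proof -
  obtain es where "char_poly A = (\<Prod>e\<leftarrow>es. [:- e, 1:])"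
    using char_poly_factorized[OF A] by blast
  then obtain B where B: "B \<in> carrier_mat n n" "upper_triangular B" "similar_mat A B"
    using schur_decomposition_exists[OF A] by blast
  then obtain P Q where wit: "similar_mat_wit A B P Q"
    unfolding similar_mat_def by blast
  have sim: "similar_mat (A ^\<^sub>m j) (B ^\<^sub>m j)" for j
    using similar_mat_wit_pow[OF wit] unfolding similar_mat_def by blast
  \<comment> \<open>The conjugacy class of the identity is a single matrix, so the finite order
    passes from A to the triangular B.\<close>
  have "similar_mat (1\<^sub>m n) (B ^\<^sub>m Suc k)"
    using sim[of "Suc k"] ord by simp
  then have one: "B ^\<^sub>m Suc k = 1\<^sub>m n"
  proof -
    obtain N P Q where *: "{B ^\<^sub>m Suc k, 1\<^sub>m n, P, Q} \<subseteq> carrier_mat N N"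
      "P * Q = 1\<^sub>m N" "B ^\<^sub>m Suc k = P * 1\<^sub>m n * Q"
      using similar_matD[OF similar_mat_sym[OF \<open>similar_mat (1\<^sub>m n) (B ^\<^sub>m Suc k)\<close>]] by blast
    from *(1) have N: "N = n" by auto
    then have "P * 1\<^sub>m n = P" using *(1) by auto
    then show ?thesis using *(2,3) N by metis
  qed
  have "B $$ (i, i) ^ Suc k = 1" if "i < n" for i
    using upper_triangular_pow_diag(2)[OF B(1,2) that, of "Suc k"] that unfolding one by simp
  then have "B $$ (i, i) ^ k = cnj (B $$ (i, i))" if "i < n" for i
    using root_of_unity_power_eq_cnj that by blast
  then have "mat_trace (B ^\<^sub>m k) = cnj (mat_trace B)"
    using B upper_triangular_pow_diag(2)[OF B(1,2)] by (simp add: mat_trace_def)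
  then show ?thesis
    using mat_trace_similar[OF sim[of k]] mat_trace_similar[OF B(3)] by simp
qed

section \<open>Schur orthogonality\<close>

locale finite_irreducible_representation = group H for H (structure) +
  fixes m :: nat and \<rho> :: "'a \<Rightarrow> complex mat"
  assumes finite_carrier: "finite (carrier H)"
    and irreducible: "irreducible_representation H m \<rho>"
begin

text \<open>Matrix entries as scalars keep all group averages below inside sums of complex numbers,
  with no matrix-valued sums.\<close>

definition entry :: "'a \<Rightarrow> nat \<Rightarrow> nat \<Rightarrow> complex" where
  "entry g i j = \<rho> g $$ (i, j)"

definition character :: "'a \<Rightarrow> complex" where
  "character g = mat_trace (\<rho> g)"

lemma degree_pos: "m > 0"
  using irreducible by (simp add: irreducible_representation_def)

lemma rho_hom: "\<rho> \<in> hom H (units_of (ring_mat TYPE(complex) m ()))"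
  using irreducible by (simp add: irreducible_representation_def representation_def)

lemma rho_carrier: "g \<in> carrier H \<Longrightarrow> \<rho> g \<in> carrier_mat m m"
  using hom_in_carrier[OF rho_hom] by (auto simp: units_of_carrier Units_def ring_mat_simps)

lemma rho_mult: "g \<in> carrier H \<Longrightarrow> h \<in> carrier H \<Longrightarrow> \<rho> (g \<otimes> h) = \<rho> g * \<rho> h"
  using hom_mult[OF rho_hom] by (simp add: units_of_mult ring_mat_simps)

lemma rho_one: "\<rho> \<one> = 1\<^sub>m m"
proof -
  interpret R: ring "ring_mat TYPE(complex) m ()" by (rule ring_mat)
  show ?thesis
    using hom_one[OF rho_hom is_group R.units_group] by (simp add: units_of_one ring_mat_simps)
qed

lemma rho_pow: "g \<in> carrier H \<Longrightarrow> \<rho> (g [^] (k::nat)) = \<rho> g ^\<^sub>m k"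
  using rho_carrier[of g] by (induction k) (auto simp: rho_one rho_mult)

lemma entry_mult:
  assumes "g \<in> carrier H" "h \<in> carrier H" "i < m" "j < m"
  shows "entry (g \<otimes> h) i j = (\<Sum>k<m. entry g i k * entry h k j)"
  using assms rho_carrier[of g] rho_carrier[of h]
  by (simp add: entry_def rho_mult scalar_prod_def atLeast0LessThan)

lemma entry_one: "i < m \<Longrightarrow> j < m \<Longrightarrow> entry \<one> i j = (if i = j then 1 else 0)"
  by (simp add: entry_def rho_one)

lemma character_entry: "g \<in> carrier H \<Longrightarrow> character g = (\<Sum>i<m. entry g i i)"
  using rho_carrier[of g] by (simp add: character_def mat_trace_def entry_def)

lemma character_one: "character \<one> = of_nat m"
  by (simp add: character_entry entry_one)

lemma character_commute:
  assumes "g \<in> carrier H" "h \<in> carrier H"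
  shows "character (g \<otimes> h) = character (h \<otimes> g)"
  using mat_trace_mult_comm[OF rho_carrier rho_carrier] assms by (simp add: character_def rho_mult)

lemma character_inv:
  assumes "g \<in> carrier H"
  shows "character (inv g) = cnj (character g)"
proof -
  \<comment> \<open>Writing |H| as a successor makes the inverse a natural power,
    \<open>inv g = g [^] k\<close>, to which the trace lemma applies.\<close>
  obtain k where k: "Coset.order H = Suc k"
    using finite_carrier order_gt_0_iff_finite gr0_implies_Suc by blast
  have pow: "g [^] Suc k = \<one>"
    using pow_order_eq_1[OF assms] k by simp
  then have "inv g = g [^] k"
    using assms by (intro inv_equality) auto
  moreover have "\<rho> g ^\<^sub>m Suc k = 1\<^sub>m m"
    using pow rho_pow[OF assms, of "Suc k"] rho_one by simp
  ultimately show ?thesis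
    using mat_trace_finite_order[OF rho_carrier[OF assms]] rho_pow[OF assms, of k]
    by (simp add: character_def)
qed

text \<open>An eigenspace of M is invariant because M commutes with the representation, and it is
  nonzero, so irreducibility makes it the whole space. An eigenvalue exists over the complex numbers
  since the degree is positive.\<close>

lemma schur_lemma:
  assumes M: "M \<in> carrier_mat m m"
    and comm: "\<And>g. g \<in> carrier H \<Longrightarrow> \<rho> g * M = M * \<rho> g"
  obtains c where "M = c \<cdot>\<^sub>m 1\<^sub>m m"
proof -
  obtain c where "eigenvalue M c"
    using spectrum_non_empty[OF M degree_pos] by (auto simp: spectrum_def)
  then obtain v where v: "v \<in> carrier_vec m" "v \<noteq> 0\<^sub>v m" "M *\<^sub>v v = c \<cdot>\<^sub>v v"
    using M by (auto simp: eigenvalue_def eigenvector_def)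
  define W where "W = {w \<in> carrier_vec m. M *\<^sub>v w = c \<cdot>\<^sub>v w}"
  interpret V: vec_space "TYPE(complex)" m .
  have "VectorSpace.subspace class_ring W (module_vec TYPE(complex) m)"
    unfolding VectorSpace.subspace_def
  proof
    show "vectorspace class_ring (module_vec TYPE(complex) m)" by (rule V.vectorspace_axioms)
    show "submodule class_ring W (module_vec TYPE(complex) m)"
      unfolding submodule_def using M
      by (auto simp: W_def module_vec_simps class_ring_simps V.module_axioms
          mult_add_distrib_mat_vec[OF M] mult_mat_vec[OF M] smult_add_distrib_vec smult_smult_assoc
          mult.commute)
  qed
  moreover have "\<forall>g\<in>carrier H. \<forall>w\<in>W. \<rho> g *\<^sub>v w \<in> W"
  proof (intro ballI)
    fix g w
    assume g: "g \<in> carrier H" and w: "w \<in> W"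
    note rg = rho_carrier[OF g]
    have wc: "w \<in> carrier_vec m" "M *\<^sub>v w = c \<cdot>\<^sub>v w" using w by (auto simp: W_def)
    have "M *\<^sub>v (\<rho> g *\<^sub>v w) = (\<rho> g * M) *\<^sub>v w"
      using comm[OF g] M rg wc(1) by (simp add: assoc_mult_mat_vec)
    also have "\<dots> = \<rho> g *\<^sub>v (c \<cdot>\<^sub>v w)"
      using M rg wc by (simp add: assoc_mult_mat_vec)
    also have "\<dots> = c \<cdot>\<^sub>v (\<rho> g *\<^sub>v w)"
      using mult_mat_vec[OF rg wc(1)] .
    finally show "\<rho> g *\<^sub>v w \<in> W" using rg wc(1) by (auto simp: W_def)
  qed
  ultimately have "W = {0\<^sub>v m} \<or> W = carrier_vec m"
    using irreducible by (simp add: irreducible_representation_def)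
  then have W: "W = carrier_vec m" using v by (auto simp: W_def)
  have "M = c \<cdot>\<^sub>m 1\<^sub>m m"
  proof (rule eq_matI)
    fix i j assume ij: "i < dim_row (c \<cdot>\<^sub>m 1\<^sub>m m)" "j < dim_col (c \<cdot>\<^sub>m 1\<^sub>m m)"
    have "unit_vec m j \<in> W" unfolding W by simp
    then have "(M *\<^sub>v unit_vec m j) $ i = (c \<cdot>\<^sub>v unit_vec m j) $ i" by (simp add: W_def)
    then show "M $$ (i, j) = (c \<cdot>\<^sub>m 1\<^sub>m m) $$ (i, j)"
      using ij M by (auto simp: scalar_prod_right_unit)
  qed (use M in auto)
  then show thesis by (rule that)
qed

lemma sum_translate_left:
  assumes "g \<in> carrier H"
  shows "(\<Sum>h\<in>carrier H. f (g \<otimes> h)) = (\<Sum>h\<in>carrier H. f h)"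
  by (rule sum.reindex_bij_witness[where i = "\<lambda>h. inv g \<otimes> h" and j = "\<lambda>h. g \<otimes> h"])
     (use assms in \<open>auto simp: m_assoc[symmetric]\<close>)

lemma sum_translate_right:
  assumes "g \<in> carrier H"
  shows "(\<Sum>h\<in>carrier H. f (h \<otimes> g)) = (\<Sum>h\<in>carrier H. f h)"
  by (rule sum.reindex_bij_witness[where i = "\<lambda>h. h \<otimes> inv g" and j = "\<lambda>h. h \<otimes> g"])
     (use assms in \<open>auto simp: m_assoc\<close>)

text \<open>Schur's lemma in coordinates: the assumption is commutation written out entry by entry,
  so that a family F given by scalar sums can be used directly.\<close>

lemma commuting_entries:
  assumes "\<And>g i l. \<lbrakk>g \<in> carrier H; i < m; l < m\<rbrakk> \<Longrightarrow>
    (\<Sum>k<m. entry g i k * F k l) = (\<Sum>k<m. F i k * entry g k l)"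
  obtains c where "\<And>i l. i < m \<Longrightarrow> l < m \<Longrightarrow> F i l = (if i = l then c else 0)"
proof -
  define M where "M = mat m m (\<lambda>(i, l). F i l)"
  have "\<rho> g * M = M * \<rho> g" if "g \<in> carrier H" for g
    using assms[OF that] rho_carrier[OF that]
    by (intro eq_matI) (auto simp: M_def scalar_prod_def entry_def atLeast0LessThan)
  then obtain c where c: "M = c \<cdot>\<^sub>m 1\<^sub>m m"
    using schur_lemma[of M] by (auto simp: M_def)
  have "F i l = (if i = l then c else 0)" if "i < m" "l < m" for i l
    using that arg_cong[OF c, of "\<lambda>X. X $$ (i, l)"] by (simp add: M_def)
  then show thesis by (rule that)
qed

text \<open>For fixed j and k the sums form the matrix of \<Sum>h. \<rho>(h^-1) E_jk \<rho>(h),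
  where E_jk is a matrix unit. It commutes with the representation, hence is a scalar c, and its
  trace determines c.\<close>

lemma entry_orthogonality:
  assumes "i < m" "j < m" "k < m" "l < m"
  shows "(\<Sum>h\<in>carrier H. entry (inv h) i j * entry h k l) =
    (if i = l \<and> j = k then of_nat (card (carrier H)) / of_nat m else 0)"
proof -
  define F where "F i l = (\<Sum>h\<in>carrier H. entry (inv h) i j * entry h k l)" for i l
  have "(\<Sum>a<m. entry g i a * F a l) = (\<Sum>a<m. F i a * entry g a l)"
    if g: "g \<in> carrier H" and il: "i < m" "l < m" for g i l
  proof -
    have "(\<Sum>a<m. entry g i a * F a l) =
        (\<Sum>h\<in>carrier H. (\<Sum>a<m. entry g i a * entry (inv h) a j) * entry h k l)"
      unfolding F_def sum_distrib_left sum_distrib_right by (subst sum.swap) (simp add: mult.assoc)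
    also have "\<dots> = (\<Sum>h\<in>carrier H. entry (g \<otimes> inv h) i j * entry h k l)"
      using g il assms by (intro sum.cong) (auto simp: entry_mult)
    \<comment> \<open>Translating h by g cancels g in the left factor and releases it in the right
      factor.\<close>
    also have "\<dots> = (\<Sum>h\<in>carrier H. entry (g \<otimes> inv (h \<otimes> g)) i j * entry (h \<otimes> g) k l)"
      using sum_translate_right[OF g, of "\<lambda>h. entry (g \<otimes> inv h) i j * entry h k l"] by simp
    also have "\<dots> = (\<Sum>h\<in>carrier H. entry (inv h) i j * entry (h \<otimes> g) k l)"
      using g by (intro sum.cong) (auto simp: inv_mult_group m_assoc[symmetric])
    also have "\<dots> = (\<Sum>h\<in>carrier H. entry (inv h) i j * (\<Sum>a<m. entry h k a * entry g a l))"
      using g il assms by (intro sum.cong) (auto simp: entry_mult)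
    also have "\<dots> = (\<Sum>a<m. F i a * entry g a l)"
      unfolding F_def sum_distrib_left sum_distrib_right by (subst sum.swap) (simp add: mult.assoc)
    finally show ?thesis .
  qed
  then obtain c where c: "\<And>i l. i < m \<Longrightarrow> l < m \<Longrightarrow> F i l = (if i = l then c else 0)"
    using commuting_entries[of F] by blast
  \<comment> \<open>The trace: exchanging the two factors turns the sum over i into an entry of
    \<rho>(h h^-1), the identity, for every h.\<close>
  have "of_nat m * c = (\<Sum>i<m. F i i)" by (simp add: c)
  also have "\<dots> = (\<Sum>h\<in>carrier H. \<Sum>i<m. entry h k i * entry (inv h) i j)"
    unfolding F_def by (subst sum.swap) (simp add: mult.commute)
  also have "\<dots> = (\<Sum>h\<in>carrier H. entry (h \<otimes> inv h) k j)"
    using assms by (intro sum.cong refl entry_mult[symmetric]) auto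
  also have "\<dots> = (if j = k then of_nat (card (carrier H)) else 0)"
    using assms by (simp add: entry_one order_def)
  finally have "c = (if j = k then of_nat (card (carrier H)) / of_nat m else 0)"
    using degree_pos by (simp add: field_simps split: if_splits)
  then show ?thesis using c[of i l] assms by (simp add: F_def)
qed

text \<open>After expansion into matrix entries, orthogonality removes every term except i = k = l,
  and what remains is the trace of \<open>\<rho> g\<close>.\<close>

lemma character_convolution:
  assumes "g \<in> carrier H"
  shows "(\<Sum>h\<in>carrier H. character (inv h) * character (h \<otimes> g)) =
    of_nat (card (carrier H)) / of_nat m * character g"
proof -
  have "(\<Sum>h\<in>carrier H. character (inv h) * character (h \<otimes> g)) =
      (\<Sum>h\<in>carrier H. (\<Sum>i<m. entry (inv h) i i) * (\<Sum>k<m. \<Sum>l<m. entry h k l * entry g l k))"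
    using assms by (intro sum.cong) (auto simp: character_entry entry_mult)
  also have "\<dots> =
      (\<Sum>h\<in>carrier H. \<Sum>i<m. \<Sum>k<m. \<Sum>l<m. entry (inv h) i i * entry h k l * entry g l k)"
    by (subst sum_distrib_right) (simp add: sum_distrib_left mult.assoc)
  also have "\<dots> = (\<Sum>i<m. \<Sum>k<m. \<Sum>l<m.
      (\<Sum>h\<in>carrier H. entry (inv h) i i * entry h k l) * entry g l k)"
    unfolding sum_distrib_right sum.swap[where A = "carrier H"] ..
  also have "\<dots> = (\<Sum>i<m. \<Sum>k<m. \<Sum>l<m.
      if l = i then (if k = i then of_nat (card (carrier H)) / of_nat m * entry g i i else 0) else 0)"
    by (intro sum.cong) (auto simp: entry_orthogonality)
  also have "\<dots> = (\<Sum>i<m. of_nat (card (carrier H)) / of_nat m * entry g i i)"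
    by simp
  finally show ?thesis using assms by (simp add: character_entry sum_distrib_left)
qed

text \<open>If the sum does not vanish, Schur's lemma makes the sum of the \<^term>\<open>\<rho> h\<close> an invertible scalar
  that absorbs every \<^term>\<open>\<rho> g\<close>, so the representation is trivial.\<close>

lemma character_sum_nonzero:
  assumes "(\<Sum>h\<in>carrier H. character h) \<noteq> 0" "g \<in> carrier H"
  shows "character g = 1"
proof -
  define F where "F i j = (\<Sum>h\<in>carrier H. entry h i j)" for i j
  have left: "(\<Sum>a<m. entry g i a * F a l) = F i l"
    if g: "g \<in> carrier H" and il: "i < m" "l < m" for g i l
  proof -
    have "(\<Sum>a<m. entry g i a * F a l) = (\<Sum>h\<in>carrier H. \<Sum>a<m. entry g i a * entry h a l)"
      unfolding F_def sum_distrib_left by (subst sum.swap) simp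
    also have "\<dots> = (\<Sum>h\<in>carrier H. entry (g \<otimes> h) i l)"
      using g il by (intro sum.cong) (auto simp: entry_mult)
    finally show ?thesis
      using sum_translate_left[OF g, of "\<lambda>h. entry h i l"] by (simp add: F_def)
  qed
  have right: "(\<Sum>a<m. F i a * entry g a l) = F i l"
    if g: "g \<in> carrier H" and il: "i < m" "l < m" for g i l
  proof -
    have "(\<Sum>a<m. F i a * entry g a l) = (\<Sum>h\<in>carrier H. \<Sum>a<m. entry h i a * entry g a l)"
      unfolding F_def sum_distrib_right by (subst sum.swap) simp
    also have "\<dots> = (\<Sum>h\<in>carrier H. entry (h \<otimes> g) i l)"
      using g il by (intro sum.cong) (auto simp: entry_mult)
    finally show ?thesis
      using sum_translate_right[OF g, of "\<lambda>h. entry h i l"] by (simp add: F_def)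
  qed
  obtain c where c: "\<And>i l. i < m \<Longrightarrow> l < m \<Longrightarrow> F i l = (if i = l then c else 0)"
  proof (rule commuting_entries[of F])
    show "(\<Sum>a<m. entry g i a * F a l) = (\<Sum>a<m. F i a * entry g a l)"
      if "g \<in> carrier H" "i < m" "l < m" for g i l
      using left[OF that] right[OF that] by simp
  qed blast
  have "(\<Sum>h\<in>carrier H. character h) = (\<Sum>i<m. F i i)"
    unfolding F_def by (subst sum.swap) (simp add: character_entry)
  then have "c \<noteq> 0" using assms by (auto simp: c)
  have "entry h i i = 1" if "h \<in> carrier H" "i < m" for h i
    using left[OF that that(2)] \<open>c \<noteq> 0\<close> that(2) by (simp add: c if_distrib cong: if_cong)
  then have const: "character h = of_nat m" if "h \<in> carrier H" for h
    using that by (simp add: character_entry)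
  \<comment> \<open>So far the character is only known to be constantly the degree m. The
    convolution identity at \<open>\<one>\<close> gives |H| m^2 = |H|, which forces m = 1.\<close>
  have "(\<Sum>h\<in>carrier H. character (inv h) * character h) = of_nat (card (carrier H))"
    using character_convolution[OF one_closed] degree_pos by (simp add: character_one)
  then have "of_nat (card (carrier H)) * (of_nat m * of_nat m) = (of_nat (card (carrier H)) :: complex)"
    by (simp add: const order_def)
  then have "card (carrier H) * (m * m) = card (carrier H)"
    using of_nat_eq_iff[where 'a = complex] by (metis of_nat_mult)
  then have "m = 1"
    using finite_carrier by (auto simp: card_gt_0_iff)
  then show ?thesis using const assms by simp
qed

end

section \<open>Sequences, permutations and Gram matrices\<close>

lemma group_perm_group: "group (perm_group n)"
proof (rule groupI)
  fix p assume "p \<in> carrier (perm_group n)"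
  then show "\<exists>q\<in>carrier (perm_group n). q \<otimes>\<^bsub>perm_group n\<^esub> p = \<one>\<^bsub>perm_group n\<^esub>"
    using permutes_inv[of p] permutes_inv_o(2)[of p]
    by (intro bexI[of _ "inv_into UNIV p"]) (auto simp: perm_group_def)
qed (auto simp: perm_group_def permutes_compose permutes_id comp_assoc)

text \<open>\<open>lex\<close> relates only lists of equal length, hence the assumption; all members
  of an orbit satisfy it.\<close>

lemma lex_less_than_linear:
  assumes "length xs = length ys"
  shows "xs = ys \<or> (xs, ys) \<in> lex less_than \<or> (ys, xs) \<in> lex less_than"
  using assms by (induction xs ys rule: list_induct2) auto

lemma lex_less_than_asym: "(xs, ys) \<in> lex less_than \<Longrightarrow> (ys, xs) \<notin> lex less_than"
  using wf_lex[OF wf_less_than] by (rule wf_not_sym)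

lemma finite_Gamma: "finite (Gamma n)"
  using finite_lists_length_eq[of "{..<n}" n] by (auto simp: Gamma_def conj_commute)

lemma prod_sum_Gamma:
  fixes f :: "nat \<Rightarrow> nat \<Rightarrow> 'a::comm_semiring_1"
  shows "(\<Prod>i<n. \<Sum>k<n. f i k) = (\<Sum>\<gamma>\<in>Gamma n. \<Prod>i<n. f i (\<gamma> ! i))"
proof -
  have "(\<Prod>i<n. \<Sum>k<n. f i k) = (\<Sum>g\<in>{..<n} \<rightarrow>\<^sub>E {..<n}. \<Prod>i<n. f i (g i))"
    by (rule prod_sum_PiE) auto
  also have "\<dots> = (\<Sum>\<gamma>\<in>Gamma n. \<Prod>i<n. f i (\<gamma> ! i))"
    by (rule sum.reindex_bij_witness[where i = "\<lambda>\<gamma>. \<lambda>i\<in>{..<n}. \<gamma> ! i" and j = "\<lambda>g. map g [0..<n]"])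
       (auto simp: Gamma_def PiE_iff extensional_def fun_eq_iff subset_iff intro!: nth_equalityI)
  finally show ?thesis .
qed

lemma mat_adjoint_carrier: "L \<in> carrier_mat n k \<Longrightarrow> mat_adjoint L \<in> carrier_mat k n"
  by (auto simp: mat_adjoint_def)

lemma mat_adjoint_index:
  fixes L :: "complex mat"
  assumes "L \<in> carrier_mat n n" "i < n" "j < n"
  shows "mat_adjoint L $$ (i, j) = cnj (L $$ (j, i))"
  using assms by (simp add: mat_adjoint_def mat_of_rows_index)

lemma det_gram_lower_triangular:
  fixes L :: "complex mat"
  assumes L: "L \<in> carrier_mat n n"
    and lower: "\<And>i j. i < n \<Longrightarrow> j < n \<Longrightarrow> i < j \<Longrightarrow> L $$ (i, j) = 0"
  shows "det (L * mat_adjoint L) = (\<Prod>i<n. L $$ (i, i)) * cnj (\<Prod>i<n. L $$ (i, i))"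
proof -
  note adj = mat_adjoint_carrier[OF L]
  have "det L = (\<Prod>i<n. L $$ (i, i))"
    using det_lower_triangular[of n L] L lower by (simp add: prod_list_diag_prod atLeast0LessThan)
  moreover have "det (mat_adjoint L) = cnj (\<Prod>i<n. L $$ (i, i))"
    using det_upper_triangular[OF _ adj] adj lower mat_adjoint_index[OF L]
    by (simp add: prod_list_diag_prod atLeast0LessThan upper_triangular_def)
  ultimately show ?thesis
    using det_mult[OF L adj] by simp
qed

section \<open>Symmetrization over a permutation group\<close>

locale irreducible_permutation_character =
  fixes n :: nat and G :: "(nat \<Rightarrow> nat) set" and \<chi> :: "(nat \<Rightarrow> nat) \<Rightarrow> complex"
  assumes subgroup_G: "subgroup G (perm_group n)"
    and irreducible: "irreducible_character (perm_subgroup n G) \<chi>"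
begin

section \<open>The permutation group and the values of its character\<close>

lemma G_permutes: "g \<in> G \<Longrightarrow> g permutes {..<n}"
  using subgroup.subset[OF subgroup_G] by (auto simp: perm_group_def)

lemma G_id: "id \<in> G"
  using subgroup.one_closed[OF subgroup_G] by (simp add: perm_group_def)

lemma G_comp: "g \<in> G \<Longrightarrow> h \<in> G \<Longrightarrow> g \<circ> h \<in> G"
  using subgroup.m_closed[OF subgroup_G] by (simp add: perm_group_def)

lemma finite_G: "finite G"
  using finite_permutations[of "{..<n}"] by (rule finite_subset[rotated]) (use G_permutes in auto)

lemma card_G: "card G > 0"
  using finite_G G_id by (auto simp: card_gt_0_iff)

lemma group_G: "group (perm_subgroup n G)"
  by (rule group.subgroup_imp_group[OF group_perm_group subgroup_G])

lemma m_inv_G: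
  assumes "g \<in> G"
  shows "m_inv (perm_subgroup n G) g = inv_into UNIV g"
proof -
  interpret H: group "perm_subgroup n G" by (rule group_G)
  have "m_inv (perm_subgroup n G) g \<circ> g = id"
    using H.l_inv[of g] assms by (simp add: perm_group_def)
  then show ?thesis
    using permutes_inv_o(1)[OF G_permutes[OF assms]]
    by (metis comp_assoc comp_id id_comp)
qed

lemma G_inv: "g \<in> G \<Longrightarrow> inv_into UNIV g \<in> G"
  using group.inv_closed[OF group_G, of g] m_inv_G by simp

lemma G_inv_o: "g \<in> G \<Longrightarrow> inv_into UNIV g \<circ> g = id" "g \<in> G \<Longrightarrow> g \<circ> inv_into UNIV g = id"
  using permutes_inv_o[OF G_permutes] by auto

text \<open>The only place where a representation realizing \<open>\<chi>\<close> is chosen; later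
  arguments use just these facts. The number \<open>\<chi> id\<close> is the degree, hence real and
  nonzero. Values of \<open>\<chi>\<close> are compared with the character on \<open>G\<close>
  alone.\<close>

lemma character_properties:
  shows chi_id: "\<chi> id \<noteq> 0" "\<chi> id \<in> \<real>"
    and chi_inv: "g \<in> G \<Longrightarrow> \<chi> (inv_into UNIV g) = cnj (\<chi> g)"
    and chi_commute: "g \<in> G \<Longrightarrow> h \<in> G \<Longrightarrow> \<chi> (g \<circ> h) = \<chi> (h \<circ> g)"
    and chi_convolution: "g \<in> G \<Longrightarrow>
      (\<Sum>h\<in>G. cnj (\<chi> h) * \<chi> (h \<circ> g)) = of_nat (card G) / \<chi> id * \<chi> g"
    and chi_sum_nonzero: "(\<Sum>h\<in>G. \<chi> h) \<noteq> 0 \<Longrightarrow> g \<in> G \<Longrightarrow> \<chi> g = 1"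
proof -
  obtain m \<rho> where irr: "irreducible_representation (perm_subgroup n G) m \<rho>"
    and chi: "\<And>g. g \<in> G \<Longrightarrow> \<chi> g = mat_trace (\<rho> g)"
    using irreducible by (auto simp: irreducible_character_def)
  interpret R: finite_irreducible_representation "perm_subgroup n G" m \<rho>
    using group_G irr finite_G
    by (simp add: finite_irreducible_representation_def finite_irreducible_representation_axioms_def)
  have chi': "\<chi> g = R.character g" if "g \<in> G" for g
    using chi[OF that] by (simp add: R.character_def)
  have mult: "g \<otimes>\<^bsub>perm_subgroup n G\<^esub> h = g \<circ> h" for g h by (simp add: perm_group_def)
  have "\<one>\<^bsub>perm_subgroup n G\<^esub> = id" by (simp add: perm_group_def)
  then have id: "\<chi> id = of_nat m" using R.character_one chi'[OF G_id] by simp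
  then show "\<chi> id \<noteq> 0" "\<chi> id \<in> \<real>" using R.degree_pos by auto
  show inv: "\<chi> (inv_into UNIV g) = cnj (\<chi> g)" if "g \<in> G" for g
    using R.character_inv[of g] that m_inv_G G_inv by (simp add: chi')
  show "\<chi> (g \<circ> h) = \<chi> (h \<circ> g)" if "g \<in> G" "h \<in> G"
    using R.character_commute[of g h] that G_comp unfolding mult by (simp add: chi')
  show "(\<Sum>h\<in>G. cnj (\<chi> h) * \<chi> (h \<circ> g)) = of_nat (card G) / \<chi> id * \<chi> g" if "g \<in> G"
  proof -
    have "cnj (\<chi> h) = R.character (m_inv (perm_subgroup n G) h)" if "h \<in> G" for h
      using inv[OF that] chi'[OF G_inv[OF that]] m_inv_G[OF that] by simp
    then have "(\<Sum>h\<in>G. cnj (\<chi> h) * \<chi> (h \<circ> g)) =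
        (\<Sum>h\<in>G. R.character (m_inv (perm_subgroup n G) h) * R.character (h \<circ> g))"
      using that G_comp by (intro sum.cong) (auto simp: chi')
    then show ?thesis
      using R.character_convolution[of g, unfolded mult] that by (simp add: id chi')
  qed
  show "\<chi> g = 1" if "(\<Sum>h\<in>G. \<chi> h) \<noteq> 0" "g \<in> G"
    using R.character_sum_nonzero[of g] that by (simp add: chi')
qed

lemma sum_G_left: "g \<in> G \<Longrightarrow> (\<Sum>h\<in>G. f (g \<circ> h)) = (\<Sum>h\<in>G. f h)"
  by (rule sum.reindex_bij_witness[where i = "\<lambda>h. inv_into UNIV g \<circ> h" and j = "\<lambda>h. g \<circ> h"])
     (auto simp: G_comp G_inv G_inv_o comp_assoc[symmetric])

lemma sum_G_right: "g \<in> G \<Longrightarrow> (\<Sum>h\<in>G. f (h \<circ> g)) = (\<Sum>h\<in>G. f h)"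
  by (rule sum.reindex_bij_witness[where i = "\<lambda>h. h \<circ> inv_into UNIV g" and j = "\<lambda>h. h \<circ> g"])
     (auto simp: G_comp G_inv G_inv_o comp_assoc)

lemma sum_G_inv: "(\<Sum>h\<in>G. f (inv_into UNIV h)) = (\<Sum>h\<in>G. f h)"
  by (rule sum.reindex_bij_witness[where i = "\<lambda>h. inv_into UNIV h" and j = "\<lambda>h. inv_into UNIV h"])
     (auto simp: G_inv permutes_inv_inv[OF G_permutes])

lemma chi_norm: "(\<Sum>g\<in>G. \<chi> g * cnj (\<chi> g)) = of_nat (card G)"
  using chi_convolution[OF G_id] chi_id by (simp add: mult.commute)

section \<open>The action on sequences\<close>

lemma length_Gamma: "\<gamma> \<in> Gamma n \<Longrightarrow> length \<gamma> = n"
  by (simp add: Gamma_def)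

text \<open>Entry i on either side is the entry of \<gamma> at g (h i). The left factor of a
  composition thus acts first: this is a right action.\<close>

lemma act_comp:
  "h \<in> G \<Longrightarrow> \<gamma> \<in> Gamma n \<Longrightarrow> permute_list (g \<circ> h) \<gamma> = permute_list h (permute_list g \<gamma>)"
  using permute_list_compose[of h \<gamma> g] G_permutes length_Gamma by simp

lemma act_Gamma: "g \<in> G \<Longrightarrow> \<gamma> \<in> Gamma n \<Longrightarrow> permute_list g \<gamma> \<in> Gamma n"
  using set_permute_list[of g \<gamma>] G_permutes by (auto simp: Gamma_def)

lemma act_inv:
  assumes "g \<in> G" "\<gamma> \<in> Gamma n"
  shows "permute_list g (permute_list (inv_into UNIV g) \<gamma>) = \<gamma>"
    "permute_list (inv_into UNIV g) (permute_list g \<gamma>) = \<gamma>"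
  using act_comp[OF assms, of "inv_into UNIV g", symmetric]
    act_comp[OF G_inv assms(2), of g g, symmetric] assms
  by (simp_all add: G_inv_o)

lemma sum_Gamma_act: "g \<in> G \<Longrightarrow> (\<Sum>\<gamma>\<in>Gamma n. f (permute_list g \<gamma>)) = (\<Sum>\<gamma>\<in>Gamma n. f \<gamma>)"
  by (rule sum.reindex_bij_witness[where i = "permute_list (inv_into UNIV g)" and j = "permute_list g"])
     (auto simp: act_inv act_Gamma G_inv)

section \<open>The symmetrizer\<close>

text \<open>In coordinates, the projection onto a symmetry class of tensors, without its usual
  factor \<chi>(e)/|G|.\<close>

definition symmetrize :: "(nat list \<Rightarrow> complex) \<Rightarrow> nat list \<Rightarrow> complex" where
  "symmetrize x \<gamma> = (\<Sum>h\<in>G. \<chi> h * x (permute_list h \<gamma>))"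

text \<open>Reindexing by \<open>g \<circ> h\<close> moves g from the sequence into the argument of
  \<open>\<chi>\<close>, where the convolution identity and the stabilizer sums can reach
  it.\<close>

lemma symmetrize_act:
  assumes "g \<in> G" "\<gamma> \<in> Gamma n"
  shows "symmetrize x (permute_list g \<gamma>) =
    (\<Sum>h\<in>G. \<chi> (inv_into UNIV g \<circ> h) * x (permute_list h \<gamma>))"
proof -
  have "symmetrize x (permute_list g \<gamma>) =
      (\<Sum>h\<in>G. \<chi> (inv_into UNIV g \<circ> (g \<circ> h)) * x (permute_list (g \<circ> h) \<gamma>))"
    unfolding symmetrize_def
    by (intro sum.cong) (auto simp: act_comp assms G_inv_o comp_assoc[symmetric])
  then show ?thesis
    using sum_G_left[OF assms(1)] by simp
qed

text \<open>Self-adjointness and T^2 = (|G|/\<chi>(e)) T in one computation. The permutation h in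
  the first factor is carried to the second by permuting the index set \<open>Gamma n\<close>; there
  it meets the sum defining T, and the convolution identity removes the sum over h.\<close>

lemma symmetrize_norm:
  "(\<Sum>\<gamma>\<in>Gamma n. symmetrize x \<gamma> * cnj (symmetrize x \<gamma>)) =
    of_nat (card G) / \<chi> id * (\<Sum>\<gamma>\<in>Gamma n. x \<gamma> * cnj (symmetrize x \<gamma>))"
proof -
  have "(\<Sum>\<gamma>\<in>Gamma n. symmetrize x \<gamma> * cnj (symmetrize x \<gamma>)) =
      (\<Sum>h\<in>G. \<Sum>\<gamma>\<in>Gamma n. \<chi> h * x (permute_list h \<gamma>) * cnj (symmetrize x \<gamma>))"
    by (subst (1) symmetrize_def, subst sum.swap) (simp add: sum_distrib_right)
  also have "\<dots> = (\<Sum>h\<in>G. \<Sum>\<gamma>\<in>Gamma n.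
      \<chi> h * x \<gamma> * cnj (symmetrize x (permute_list (inv_into UNIV h) \<gamma>)))"
  proof (rule sum.cong[OF refl])
    fix h assume h: "h \<in> G"
    have "(\<Sum>\<gamma>\<in>Gamma n. \<chi> h * x (permute_list h \<gamma>) * cnj (symmetrize x \<gamma>)) =
      (\<Sum>\<gamma>\<in>Gamma n. \<chi> h * x (permute_list h \<gamma>) *
        cnj (symmetrize x (permute_list (inv_into UNIV h) (permute_list h \<gamma>))))"
      using h by (intro sum.cong) (auto simp: act_inv)
    then show "(\<Sum>\<gamma>\<in>Gamma n. \<chi> h * x (permute_list h \<gamma>) * cnj (symmetrize x \<gamma>)) =
      (\<Sum>\<gamma>\<in>Gamma n. \<chi> h * x \<gamma> * cnj (symmetrize x (permute_list (inv_into UNIV h) \<gamma>)))"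
      using sum_Gamma_act[OF h] by simp
  qed
  also have "\<dots> = (\<Sum>\<gamma>\<in>Gamma n. \<Sum>h\<in>G. \<Sum>k\<in>G.
      x \<gamma> * cnj (x (permute_list k \<gamma>)) * cnj (cnj (\<chi> h) * \<chi> (h \<circ> k)))"
    by (subst sum.swap, intro sum.cong)
       (auto simp: symmetrize_act G_inv permutes_inv_inv[OF G_permutes] sum_distrib_left mult_ac)
  also have "\<dots> = (\<Sum>\<gamma>\<in>Gamma n. \<Sum>k\<in>G.
      x \<gamma> * cnj (x (permute_list k \<gamma>)) * cnj (\<Sum>h\<in>G. cnj (\<chi> h) * \<chi> (h \<circ> k)))"
    unfolding cnj_sum sum_distrib_left by (subst sum.swap[where A = G]) simp
  \<comment> \<open>The convolution identity appears under a conjugation, which leaves its constant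
    unchanged because \<open>\<chi> id\<close> is real.\<close>
  also have "\<dots> = (\<Sum>\<gamma>\<in>Gamma n. \<Sum>k\<in>G.
      of_nat (card G) / \<chi> id * (x \<gamma> * cnj (\<chi> k * x (permute_list k \<gamma>))))"
    using chi_id(2) by (intro sum.cong) (auto simp: chi_convolution Reals_cnj_iff)
  finally show ?thesis
    by (simp add: symmetrize_def sum_distrib_left)
qed

section \<open>Stabilizers and vanishing outside \<open>Omega\<close>\<close>

lemma stabilizer_subset: "seq_stabilizer G \<gamma> \<subseteq> G"
  by (auto simp: seq_stabilizer_def)

lemma id_stabilizer: "id \<in> seq_stabilizer G \<gamma>"
  using G_id by (simp add: seq_stabilizer_def)

lemma stabilizer_comp:
  assumes "\<gamma> \<in> Gamma n" "s \<in> seq_stabilizer G \<gamma>" "t \<in> seq_stabilizer G \<gamma>"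
  shows "s \<circ> t \<in> seq_stabilizer G \<gamma>"
  using assms by (auto simp: seq_stabilizer_def G_comp act_comp)

lemma stabilizer_inv:
  assumes "\<gamma> \<in> Gamma n" "s \<in> seq_stabilizer G \<gamma>"
  shows "inv_into UNIV s \<in> seq_stabilizer G \<gamma>"
  using assms act_inv(2)[of s \<gamma>] by (auto simp: seq_stabilizer_def G_inv)

text \<open>Writing $f(h) = \sum_s \chi(s h)$, the convolution identity gives
  $\sum_h |f(h)|^2 = \frac{|G|}{\chi(e)} |G_\gamma| \sum_s \chi(s) = 0$.\<close>

lemma stabilizer_character_sum_zero:
  assumes gamma: "\<gamma> \<in> Gamma n" "\<gamma> \<notin> Omega n G \<chi>" and g: "g \<in> G"
  shows "(\<Sum>s\<in>seq_stabilizer G \<gamma>. \<chi> (s \<circ> g)) = 0"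
proof -
  let ?S = "seq_stabilizer G \<gamma>"
  have finS: "finite ?S" using finite_G stabilizer_subset by (rule finite_subset[rotated])
  have S: "s \<in> G" if "s \<in> ?S" for s using that stabilizer_subset by blast
  have zero: "(\<Sum>s\<in>?S. \<chi> s) = 0"
    using gamma finS id_stabilizer by (auto simp: Omega_def)
  have shift: "(\<Sum>s\<in>?S. \<chi> (inv_into UNIV t \<circ> s)) = (\<Sum>s\<in>?S. \<chi> s)" if "t \<in> ?S" for t
    by (rule sum.reindex_bij_witness[where i = "\<lambda>s. t \<circ> s" and j = "\<lambda>s. inv_into UNIV t \<circ> s"])
       (use that S gamma in \<open>auto simp: stabilizer_comp stabilizer_inv G_inv_o comp_assoc[symmetric]\<close>)
  define f where "f h = (\<Sum>s\<in>?S. \<chi> (s \<circ> h))" for h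
  have "(\<Sum>h\<in>G. f h * cnj (f h)) =
      (\<Sum>h\<in>G. \<Sum>t\<in>?S. \<Sum>s\<in>?S. cnj (\<chi> (t \<circ> h)) * \<chi> (s \<circ> h))"
    unfolding f_def cnj_sum sum_product
    by (rule sum.cong[OF refl], subst sum.swap, simp add: mult.commute)
  also have "\<dots> = (\<Sum>t\<in>?S. \<Sum>s\<in>?S. \<Sum>h\<in>G. cnj (\<chi> (t \<circ> h)) * \<chi> (s \<circ> h))"
    by (subst sum.swap, rule sum.cong[OF refl], rule sum.swap)
  also have "\<dots> = (\<Sum>t\<in>?S. \<Sum>s\<in>?S. of_nat (card G) / \<chi> id * \<chi> (inv_into UNIV t \<circ> s))"
  proof (intro sum.cong refl)
    fix t s assume ts: "t \<in> ?S" "s \<in> ?S"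
    \<comment> \<open>The convolution identity has the summation variable on the left;
      \<open>\<chi>\<close> is a class function, so h can be brought there and then absorb
      t.\<close>
    have "(\<Sum>h\<in>G. cnj (\<chi> (t \<circ> h)) * \<chi> (s \<circ> h)) =
        (\<Sum>h\<in>G. cnj (\<chi> (h \<circ> t)) * \<chi> (h \<circ> s))"
      using ts S by (intro sum.cong) (auto simp: chi_commute)
    also have "\<dots> = (\<Sum>h\<in>G. cnj (\<chi> (h \<circ> t)) * \<chi> ((h \<circ> t) \<circ> (inv_into UNIV t \<circ> s)))"
      using ts S G_inv_o(2)[OF S[OF ts(1)]] by (metis (no_types, lifting) comp_assoc comp_id)
    also have "\<dots> = (\<Sum>h\<in>G. cnj (\<chi> h) * \<chi> (h \<circ> (inv_into UNIV t \<circ> s)))"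
      using sum_G_right[OF S[OF ts(1)]] .
    also have "\<dots> = of_nat (card G) / \<chi> id * \<chi> (inv_into UNIV t \<circ> s)"
      using ts S by (intro chi_convolution) (auto simp: G_comp G_inv)
    finally show "(\<Sum>h\<in>G. cnj (\<chi> (t \<circ> h)) * \<chi> (s \<circ> h)) =
        of_nat (card G) / \<chi> id * \<chi> (inv_into UNIV t \<circ> s)" .
  qed
  also have "\<dots> = 0"
    unfolding sum_distrib_left[symmetric] using shift zero by simp
  finally have "(\<Sum>h\<in>G. f h * cnj (f h)) = 0" .
  then have "of_real (\<Sum>h\<in>G. (cmod (f h))\<^sup>2) = (0::complex)"
    unfolding of_real_sum complex_norm_square .
  then have "(\<Sum>h\<in>G. (cmod (f h))\<^sup>2) = 0"
    unfolding of_real_eq_0_iff .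
  then have "f g = 0"
    using g finite_G by (simp add: sum_nonneg_eq_0_iff)
  then show ?thesis by (simp add: f_def)
qed

text \<open>Replacing h by \<open>s \<circ> h\<close> with s in the stabilizer does not change x at
  h \<cdot> \<gamma>. Summing over all s therefore replaces \<open>\<chi>\<close> by its sums over
  cosets of the stabilizer, which vanish by the previous lemma.\<close>

lemma symmetrize_vanishes:
  assumes gamma: "\<gamma> \<in> Gamma n" "\<gamma> \<notin> Omega n G \<chi>" and g: "g \<in> G"
  shows "symmetrize x (permute_list g \<gamma>) = 0"
proof -
  let ?S = "seq_stabilizer G \<gamma>"
  have S: "s \<in> G" if "s \<in> ?S" for s using that stabilizer_subset by blast
  have shift: "symmetrize x (permute_list g \<gamma>) =
      (\<Sum>h\<in>G. \<chi> (inv_into UNIV g \<circ> (s \<circ> h)) * x (permute_list h \<gamma>))" if "s \<in> ?S" for s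
  proof -
    have "x (permute_list (s \<circ> h) \<gamma>) = x (permute_list h \<gamma>)" if "h \<in> G" for h
      using that \<open>s \<in> ?S\<close> gamma by (simp add: act_comp) (simp add: seq_stabilizer_def)
    then show ?thesis
      unfolding symmetrize_act[OF g gamma(1)]
      using sum_G_left[OF S[OF that], of "\<lambda>h. \<chi> (inv_into UNIV g \<circ> h) * x (permute_list h \<gamma>)"]
      by simp
  qed
  have "of_nat (card ?S) * symmetrize x (permute_list g \<gamma>) =
      (\<Sum>s\<in>?S. \<Sum>h\<in>G. \<chi> (inv_into UNIV g \<circ> (s \<circ> h)) * x (permute_list h \<gamma>))"
    unfolding sum_constant[symmetric] by (rule sum.cong) (auto simp: shift)
  also have "\<dots> = (\<Sum>h\<in>G. (\<Sum>s\<in>?S. \<chi> (s \<circ> (h \<circ> inv_into UNIV g))) * x (permute_list h \<gamma>))"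
    unfolding sum_distrib_right
    by (subst sum.swap, intro sum.cong refl)
       (use S g G_comp G_inv in \<open>auto simp: chi_commute[of "inv_into UNIV g"] comp_assoc\<close>)
  also have "\<dots> = 0"
    using g by (intro sum.neutral) (simp add: stabilizer_character_sum_zero[OF gamma] G_comp G_inv)
  finally show ?thesis
    using id_stabilizer finite_subset[OF stabilizer_subset finite_G] by auto
qed

section \<open>Orbits, representatives and cosets\<close>

text \<open>Well-foundedness of \<open>lex less_than\<close> supplies a minimal member of the orbit;
  linearity on lists of equal length makes it the least one, as \<open>Delta\<close>
  demands.\<close>

lemma orbit_representative:
  assumes "\<gamma> \<in> Gamma n"
  obtains \<delta> where "\<delta> \<in> Delta n G" "\<gamma> \<in> seq_orbit G \<delta>" "\<delta> \<in> seq_orbit G \<gamma>"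
proof -
  have "\<gamma> \<in> seq_orbit G \<gamma>"
    using G_id by (force simp: seq_orbit_def)
  then obtain \<delta> where d: "\<delta> \<in> seq_orbit G \<gamma>"
    and min: "\<And>\<epsilon>. (\<epsilon>, \<delta>) \<in> lex less_than \<Longrightarrow> \<epsilon> \<notin> seq_orbit G \<gamma>"
    using wfE_min[OF wf_lex[OF wf_less_than], of \<gamma> "seq_orbit G \<gamma>" thesis] by metis
  then obtain g where g: "g \<in> G" "\<delta> = permute_list g \<gamma>"
    by (auto simp: seq_orbit_def)
  have dG: "\<delta> \<in> Gamma n" using g assms act_Gamma by simp
  have "\<gamma> = permute_list (inv_into UNIV g) \<delta>" using g assms act_inv by simp
  then have "\<gamma> \<in> seq_orbit G \<delta>" using g G_inv by (auto simp: seq_orbit_def)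
  moreover have "\<delta> \<in> Delta n G"
    unfolding Delta_def
  proof (intro CollectI conjI ballI)
    fix \<epsilon> assume "\<epsilon> \<in> seq_orbit G \<delta>"
    then obtain h where h: "h \<in> G" "\<epsilon> = permute_list h \<delta>" by (auto simp: seq_orbit_def)
    then have "\<epsilon> = permute_list (g \<circ> h) \<gamma>" using g assms act_comp by simp
    then have "\<epsilon> \<in> seq_orbit G \<gamma>" using g h G_comp by (auto simp: seq_orbit_def)
    then show "\<epsilon> = \<delta> \<or> (\<delta>, \<epsilon>) \<in> lex less_than"
      using min[of \<epsilon>] lex_less_than_linear[of \<epsilon> \<delta>] h by auto
  qed (rule dG)
  ultimately show thesis using that d by blast
qed

lemma orbit_representative_unique:
  assumes "\<delta> \<in> Delta n G" "\<epsilon> \<in> Delta n G" "\<gamma> \<in> seq_orbit G \<delta>" "\<gamma> \<in> seq_orbit G \<epsilon>"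
  shows "\<delta> = \<epsilon>"
proof -
  have *: "\<epsilon> \<in> seq_orbit G \<delta>" if mem: "\<delta> \<in> Gamma n" "\<epsilon> \<in> Gamma n"
    "\<gamma> \<in> seq_orbit G \<delta>" "\<gamma> \<in> seq_orbit G \<epsilon>" for \<delta> \<epsilon>
  proof -
    obtain g h where gh: "g \<in> G" "\<gamma> = permute_list g \<delta>" "h \<in> G" "\<gamma> = permute_list h \<epsilon>"
      using mem(3,4) unfolding seq_orbit_def by blast
    then have "\<epsilon> = permute_list (inv_into UNIV h) (permute_list g \<delta>)"
      using act_inv mem by metis
    then have "\<epsilon> = permute_list (g \<circ> inv_into UNIV h) \<delta>"
      using mem gh by (simp add: act_comp G_inv)
    then show ?thesis using gh by (auto simp: seq_orbit_def G_inv G_comp)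
  qed
  have "\<delta> \<in> Gamma n" "\<epsilon> \<in> Gamma n"
    using assms(1,2) by (auto simp: Delta_def)
  then have "\<epsilon> \<in> seq_orbit G \<delta>" "\<delta> \<in> seq_orbit G \<epsilon>"
    using *[OF _ _ assms(3,4)] *[OF _ _ assms(4,3)] by auto
  then have "\<epsilon> = \<delta> \<or> (\<delta>, \<epsilon>) \<in> lex less_than" "\<delta> = \<epsilon> \<or> (\<epsilon>, \<delta>) \<in> lex less_than"
    using assms(1,2) by (simp_all add: Delta_def)
  then show ?thesis
    using lex_less_than_asym[of \<delta> \<epsilon>] by blast
qed

text \<open>The cosets are the fibres of the orbit map, so one representative per coset means one
  group element per point of the orbit.\<close>

lemma rcoset_stabilizer:
  assumes "\<gamma> \<in> Gamma n" "a \<in> G"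
  shows "seq_stabilizer G \<gamma> #>\<^bsub>perm_subgroup n G\<^esub> a =
    {g \<in> G. permute_list g \<gamma> = permute_list a \<gamma>}" (is "?L = ?R")
proof
  show "?L \<subseteq> ?R"
    using assms by (auto simp: r_coset_def perm_group_def seq_stabilizer_def G_comp act_comp)
  show "?R \<subseteq> ?L"
  proof
    fix g assume g: "g \<in> ?R"
    have "g \<circ> inv_into UNIV a \<in> seq_stabilizer G \<gamma>"
      using g assms by (auto simp: seq_stabilizer_def G_comp G_inv act_comp act_inv)
    moreover have "g = (g \<circ> inv_into UNIV a) \<circ> a"
      using assms by (simp add: comp_assoc G_inv_o)
    ultimately show "g \<in> ?L"
      unfolding r_coset_def by (auto simp: perm_group_def intro!: bexI[of _ "g \<circ> inv_into UNIV a"])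
  qed
qed

lemma coset_reps_bij:
  assumes "\<gamma> \<in> Gamma n" "stabilizer_coset_reps n G \<gamma> R"
  shows "bij_betw (\<lambda>g. permute_list g \<gamma>) R (seq_orbit G \<gamma>)"
proof -
  have R: "R \<subseteq> G" using assms by (simp add: stabilizer_coset_reps_def)
  have ex1: "\<exists>!g. g \<in> R \<and> permute_list g \<gamma> = permute_list a \<gamma>" if "a \<in> G" for a
  proof -
    have "\<exists>!g. g \<in> R \<inter> (seq_stabilizer G \<gamma> #>\<^bsub>perm_subgroup n G\<^esub> a)"
      using assms(2) that unfolding stabilizer_coset_reps_def RCOSETS_def by auto
    moreover have "R \<inter> (seq_stabilizer G \<gamma> #>\<^bsub>perm_subgroup n G\<^esub> a) =
        {g \<in> R. permute_list g \<gamma> = permute_list a \<gamma>}"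
      unfolding rcoset_stabilizer[OF assms(1) that] using R by auto
    ultimately have "\<exists>!g. g \<in> {g \<in> R. permute_list g \<gamma> = permute_list a \<gamma>}" by (simp only:)
    then show ?thesis by simp
  qed
  show ?thesis
  proof (rule bij_betwI')
    fix g h assume "g \<in> R" "h \<in> R"
    then show "(permute_list g \<gamma> = permute_list h \<gamma>) = (g = h)"
      using ex1[of h] R by blast
  next
    fix g assume "g \<in> R"
    then show "permute_list g \<gamma> \<in> seq_orbit G \<gamma>" using R by (auto simp: seq_orbit_def)
  next
    fix \<delta> assume "\<delta> \<in> seq_orbit G \<gamma>"
    then show "\<exists>g\<in>R. \<delta> = permute_list g \<gamma>" using ex1 by (auto simp: seq_orbit_def) metis
  qed
qed

text \<open>Stated for an invariant subset B so that the special classes of sequences can be left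
  out. Invariance keeps the representative of each orbit that meets B inside B.\<close>

lemma sum_over_orbits:
  fixes f :: "nat list \<Rightarrow> complex"
  assumes B: "B \<subseteq> Gamma n" and inv: "\<And>g \<gamma>. g \<in> G \<Longrightarrow> \<gamma> \<in> B \<Longrightarrow> permute_list g \<gamma> \<in> B"
    and R: "\<And>\<gamma>. \<gamma> \<in> Gamma n \<Longrightarrow> stabilizer_coset_reps n G \<gamma> (R \<gamma>)"
  shows "(\<Sum>\<gamma>\<in>B. f \<gamma>) = (\<Sum>\<gamma>\<in>B \<inter> Delta n G. \<Sum>g\<in>R \<gamma>. f (permute_list g \<gamma>))"
proof -
  have "B = (\<Union>\<gamma>\<in>B \<inter> Delta n G. seq_orbit G \<gamma>)"
  proof
    show "B \<subseteq> (\<Union>\<gamma>\<in>B \<inter> Delta n G. seq_orbit G \<gamma>)"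
    proof
      fix \<gamma> assume "\<gamma> \<in> B"
      then obtain \<delta> where d: "\<delta> \<in> Delta n G" "\<gamma> \<in> seq_orbit G \<delta>" "\<delta> \<in> seq_orbit G \<gamma>"
        using B orbit_representative by blast
      obtain g where "g \<in> G" "\<delta> = permute_list g \<gamma>"
        using d(3) by (auto simp: seq_orbit_def)
      then have "\<delta> \<in> B" using inv \<open>\<gamma> \<in> B\<close> by simp
      then show "\<gamma> \<in> (\<Union>\<gamma>\<in>B \<inter> Delta n G. seq_orbit G \<gamma>)" using d by blast
    qed
  qed (use inv in \<open>auto simp: seq_orbit_def\<close>)
  then have "(\<Sum>\<gamma>\<in>B. f \<gamma>) = (\<Sum>\<gamma>\<in>(\<Union>\<gamma>\<in>B \<inter> Delta n G. seq_orbit G \<gamma>). f \<gamma>)" by simp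
  also have "\<dots> = (\<Sum>\<gamma>\<in>B \<inter> Delta n G. \<Sum>\<delta>\<in>seq_orbit G \<gamma>. f \<delta>)"
    using finite_subset[OF B finite_Gamma] finite_G orbit_representative_unique
    by (intro sum.UNION_disjoint) (auto simp: seq_orbit_def[of G, THEN arg_cong[of _ _ finite]])
  also have "\<dots> = (\<Sum>\<gamma>\<in>B \<inter> Delta n G. \<Sum>g\<in>R \<gamma>. f (permute_list g \<gamma>))"
    using B by (intro sum.cong refl sum.reindex_bij_betw[symmetric] coset_reps_bij R) auto
  finally show ?thesis .
qed


section \<open>Generalized matrix functions in terms of the symmetrizer\<close>

text \<open>Multiplying by \<open>P_g\<close> turns column selection by \<gamma> into column
  selection by g \<cdot> \<gamma>; the diagonal product along h is then x at h \<cdot> (g \<cdot>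
  \<gamma>).\<close>

lemma gen_mat_fun_select_cols:
  assumes "\<gamma> \<in> Gamma n" "g \<in> G"
  shows "gen_mat_fun n G \<chi> (select_cols n L \<gamma> * perm_matrix n g) =
    symmetrize (\<lambda>\<gamma>. \<Prod>i<n. L $$ (i, \<gamma> ! i)) (permute_list g \<gamma>)"
proof -
  have entry: "(select_cols n L \<gamma> * perm_matrix n g) $$ (i, j) = L $$ (i, permute_list g \<gamma> ! j)"
    if "i < n" "j < n" for i j
  proof -
    have gj: "g j < n" using permutes_in_image[OF G_permutes[OF assms(2)], of j] that by simp
    have "(select_cols n L \<gamma> * perm_matrix n g) $$ (i, j) =
        (\<Sum>k<n. L $$ (i, \<gamma> ! k) * (if k = g j then 1 else 0))"
      using that by (simp add: select_cols_def perm_matrix_def scalar_prod_def atLeast0LessThan)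
    also have "\<dots> = L $$ (i, \<gamma> ! g j)"
      using gj by (simp add: if_distrib[of "(*) _"] cong: if_cong)
    finally show ?thesis
      using that assms G_permutes length_Gamma by (simp add: permute_list_nth)
  qed
  show ?thesis
    unfolding gen_mat_fun_def symmetrize_def
  proof (intro sum.cong refl arg_cong[of _ _ "(*) _"] prod.cong)
    fix h i assume h: "h \<in> G" and i: "i \<in> {..<n}"
    have "h i < n" using permutes_in_image[OF G_permutes[OF h], of i] i by simp
    then show "(select_cols n L \<gamma> * perm_matrix n g) $$ (i, h i) =
        L $$ (i, permute_list h (permute_list g \<gamma>) ! i)"
      using i h assms G_permutes length_Gamma by (simp add: entry permute_list_nth)
  qed
qed

text \<open>The product of the row sums expands over \<open>Gamma n\<close>. Reindexing the
  conjugated factors by g makes them x at g^-1 \<cdot> \<gamma>, and replacing g by its inverse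
  turns \<open>\<chi>\<close> into its conjugate, which assembles the conjugate of T x.\<close>

lemma gen_mat_fun_gram:
  fixes L :: "complex mat"
  assumes L: "L \<in> carrier_mat n n"
  defines "x \<equiv> (\<lambda>\<gamma>. \<Prod>i<n. L $$ (i, \<gamma> ! i))"
  shows "gen_mat_fun n G \<chi> (L * mat_adjoint L) = (\<Sum>\<gamma>\<in>Gamma n. x \<gamma> * cnj (symmetrize x \<gamma>))"
proof -
  have entry: "(L * mat_adjoint L) $$ (i, j) = (\<Sum>k<n. L $$ (i, k) * cnj (L $$ (j, k)))"
    if "i < n" "j < n" for i j
    using L mat_adjoint_carrier[OF L] that
    by (simp add: scalar_prod_def atLeast0LessThan mat_adjoint_index[OF L])
  have "(\<Prod>i<n. (L * mat_adjoint L) $$ (i, g i)) =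
      (\<Sum>\<gamma>\<in>Gamma n. x \<gamma> * cnj (x (permute_list (inv_into UNIV g) \<gamma>)))" if g: "g \<in> G" for g
  proof -
    have perm: "g permutes {..<n}" "inv_into UNIV g permutes {..<n}"
      using G_permutes g G_inv by auto
    have "(\<Prod>i<n. (L * mat_adjoint L) $$ (i, g i)) = (\<Prod>i<n. \<Sum>k<n. L $$ (i, k) * cnj (L $$ (g i, k)))"
      using permutes_in_image[OF perm(1)] by (intro prod.cong) (auto simp: entry)
    also have "\<dots> = (\<Sum>\<gamma>\<in>Gamma n. \<Prod>i<n. L $$ (i, \<gamma> ! i) * cnj (L $$ (g i, \<gamma> ! i)))"
      by (rule prod_sum_Gamma)
    also have "\<dots> = (\<Sum>\<gamma>\<in>Gamma n. x \<gamma> * cnj (x (permute_list (inv_into UNIV g) \<gamma>)))"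
    proof (intro sum.cong refl)
      fix \<gamma> assume \<gamma>: "\<gamma> \<in> Gamma n"
      have "(\<Prod>i<n. cnj (L $$ (g i, \<gamma> ! i))) =
          (\<Prod>i<n. cnj (L $$ (g i, \<gamma> ! (inv_into UNIV g (g i)))))"
        using permutes_inverses(2)[OF perm(1)] by simp
      also have "\<dots> = (\<Prod>i<n. cnj (L $$ (i, \<gamma> ! (inv_into UNIV g i))))"
        using prod.permute[OF perm(1), of "\<lambda>i. cnj (L $$ (i, \<gamma> ! (inv_into UNIV g i)))"]
        by (simp add: comp_def)
      finally show "(\<Prod>i<n. L $$ (i, \<gamma> ! i) * cnj (L $$ (g i, \<gamma> ! i))) =
          x \<gamma> * cnj (x (permute_list (inv_into UNIV g) \<gamma>))"
        using perm(2) length_Gamma[OF \<gamma>] by (simp add: x_def prod.distrib permute_list_nth)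
    qed
    finally show ?thesis .
  qed
  then have "gen_mat_fun n G \<chi> (L * mat_adjoint L) =
      (\<Sum>g\<in>G. \<chi> g * (\<Sum>\<gamma>\<in>Gamma n. x \<gamma> * cnj (x (permute_list (inv_into UNIV g) \<gamma>))))"
    by (simp add: gen_mat_fun_def)
  also have "\<dots> = (\<Sum>g\<in>G. cnj (\<chi> (inv_into UNIV g)) *
      (\<Sum>\<gamma>\<in>Gamma n. x \<gamma> * cnj (x (permute_list (inv_into UNIV g) \<gamma>))))"
    by (simp add: chi_inv)
  also have "\<dots> = (\<Sum>g\<in>G. cnj (\<chi> g) * (\<Sum>\<gamma>\<in>Gamma n. x \<gamma> * cnj (x (permute_list g \<gamma>))))"
    by (rule sum_G_inv)
  also have "\<dots> = (\<Sum>\<gamma>\<in>Gamma n. x \<gamma> * cnj (symmetrize x \<gamma>))"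
    unfolding sum_distrib_left symmetrize_def cnj_sum by (subst sum.swap) (simp add: mult_ac)
  finally show ?thesis .
qed

section \<open>Contributions of rearrangements, constant sequences and the rest\<close>

text \<open>Among rearrangements, x can be nonzero only at (0,...,n-1). Hence T x is a multiple of
  \<open>\<chi>\<close> at inverses on \<open>G\<close> and zero on the other permutations, and the
  squared norm of \<open>\<chi>\<close> supplies the factor |G|.\<close>

lemma symmetrize_norm_permutations:
  fixes L :: "complex mat"
  assumes lower: "\<And>i j. i < n \<Longrightarrow> j < n \<Longrightarrow> i < j \<Longrightarrow> L $$ (i, j) = 0"
  defines "x \<equiv> (\<lambda>\<gamma>. \<Prod>i<n. L $$ (i, \<gamma> ! i))"
  shows "(\<Sum>\<gamma>\<in>{\<gamma>\<in>Gamma n. mset \<gamma> = mset [0..<n]}. symmetrize x \<gamma> * cnj (symmetrize x \<gamma>)) =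
    of_nat (card G) * ((\<Prod>i<n. L $$ (i, i)) * cnj (\<Prod>i<n. L $$ (i, i)))"
proof -
  let ?P = "{p. p permutes {..<n}}" and ?e = "[0..<n]"
  define d where "d = (\<Prod>i<n. L $$ (i, i))"
  have e: "?e \<in> Gamma n" by (auto simp: Gamma_def)
  have bij: "bij_betw (\<lambda>p. permute_list p ?e) ?P {\<gamma>\<in>Gamma n. mset \<gamma> = mset ?e}"
    unfolding bij_betw_def
  proof
    show "inj_on (\<lambda>p. permute_list p ?e) ?P"
    proof (rule inj_onI)
      fix p q assume pq: "p \<in> ?P" "q \<in> ?P" "permute_list p ?e = permute_list q ?e"
      show "p = q"
      proof
        fix i show "p i = q i"
        proof (cases "i < n")
          case True
          then have "permute_list p ?e ! i = p i" "permute_list q ?e ! i = q i"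
            using pq(1,2) permutes_in_image[of p "{..<n}" i] permutes_in_image[of q "{..<n}" i]
            by (auto simp: permute_list_nth)
          then show ?thesis using pq(3) by simp
        next
          case False
          then show ?thesis using pq(1,2) by (auto simp: permutes_def)
        qed
      qed
    qed
    show "(\<lambda>p. permute_list p ?e) ` ?P = {\<gamma>\<in>Gamma n. mset \<gamma> = mset ?e}"
    proof
      show "(\<lambda>p. permute_list p ?e) ` ?P \<subseteq> {\<gamma>\<in>Gamma n. mset \<gamma> = mset ?e}"
      proof (rule image_subsetI)
        fix p assume "p \<in> ?P"
        then have p: "p permutes {..<length ?e}" by simp
        show "permute_list p ?e \<in> {\<gamma>\<in>Gamma n. mset \<gamma> = mset ?e}"
          using set_permute_list[OF p] mset_permute_list[OF p] by (auto simp: Gamma_def)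
      qed
      show "{\<gamma>\<in>Gamma n. mset \<gamma> = mset ?e} \<subseteq> (\<lambda>p. permute_list p ?e) ` ?P"
      proof
        fix \<gamma> assume "\<gamma> \<in> {\<gamma>\<in>Gamma n. mset \<gamma> = mset ?e}"
        then obtain p where "p permutes {..<length ?e}" "permute_list p ?e = \<gamma>"
          using mset_eq_permutation[of \<gamma> ?e] by auto
        then show "\<gamma> \<in> (\<lambda>p. permute_list p ?e) ` ?P" by force
      qed
    qed
  qed
  have x: "x (permute_list p ?e) = (if p = id then d else 0)" if p: "p permutes {..<n}" for p
  proof (cases "p = id")
    case False
    \<comment> \<open>A permutation that raises no index is the identity; a raised index selects an
      entry above the diagonal.\<close>
    then obtain i where i: "i < n" "i < p i"
      using permutes_natset_le[OF p] by (meson lessThan_iff not_le)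
    have "p i < n" using permutes_in_image[OF p, of i] i by simp
    then have "L $$ (i, permute_list p ?e ! i) = 0"
      using i p lower by (simp add: permute_list_nth)
    then show ?thesis using False i by (auto simp: x_def)
  qed (simp add: x_def d_def)
  have sym: "symmetrize x (permute_list p ?e) = (if p \<in> G then \<chi> (inv_into UNIV p) * d else 0)"
    if p: "p permutes {..<n}" for p
  proof -
    have inv_iff: "p \<circ> h = id \<longleftrightarrow> h = inv_into UNIV p" for h
      using permutes_inv_o[OF p] by (metis comp_assoc comp_id id_comp)
    have mem: "inv_into UNIV p \<in> G \<longleftrightarrow> p \<in> G"
      using G_inv permutes_inv_inv[OF p] by metis
    have "symmetrize x (permute_list p ?e) = (\<Sum>h\<in>G. \<chi> h * x (permute_list (p \<circ> h) ?e))"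
      unfolding symmetrize_def using e by (intro sum.cong) (auto simp: act_comp)
    also have "\<dots> = (\<Sum>h\<in>G. if h = inv_into UNIV p then \<chi> h * d else 0)"
      using p G_permutes by (intro sum.cong) (auto simp: x permutes_compose inv_iff)
    finally show ?thesis using finite_G mem by simp
  qed
  have "(\<Sum>\<gamma>\<in>{\<gamma>\<in>Gamma n. mset \<gamma> = mset ?e}. symmetrize x \<gamma> * cnj (symmetrize x \<gamma>)) =
      (\<Sum>p\<in>?P. symmetrize x (permute_list p ?e) * cnj (symmetrize x (permute_list p ?e)))"
    by (rule sum.reindex_bij_betw[OF bij, symmetric])
  also have "\<dots> = (\<Sum>p\<in>?P. if p \<in> G
      then \<chi> (inv_into UNIV p) * cnj (\<chi> (inv_into UNIV p)) * (d * cnj d) else 0)"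
    by (intro sum.cong) (auto simp: sym)
  also have "\<dots> = (\<Sum>p\<in>G. \<chi> (inv_into UNIV p) * cnj (\<chi> (inv_into UNIV p)) * (d * cnj d))"
    using finite_permutations[of "{..<n}"] G_permutes
    by (intro sum.mono_neutral_cong_right) auto
  also have "\<dots> = (\<Sum>p\<in>G. \<chi> p * cnj (\<chi> p)) * (d * cnj d)"
    unfolding sum_distrib_right by (rule sum_G_inv)
  finally show ?thesis by (simp add: chi_norm d_def)
qed

text \<open>Constant sequences are fixed by \<open>G\<close>, so T multiplies x there by \<Sum>h.
  \<chi>(h), which is |G| or 0. The first row of L vanishes beyond column 0, so only the constant 0
  contributes.\<close>

lemma symmetrize_norm_constant:
  fixes L :: "complex mat"
  assumes "n > 0" and lower: "\<And>i j. i < n \<Longrightarrow> j < n \<Longrightarrow> i < j \<Longrightarrow> L $$ (i, j) = 0"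
  defines "x \<equiv> (\<lambda>\<gamma>. \<Prod>i<n. L $$ (i, \<gamma> ! i))"
  shows "(\<Sum>\<gamma>\<in>replicate n ` {..<n}. symmetrize x \<gamma> * cnj (symmetrize x \<gamma>)) =
    (if principal_character (perm_subgroup n G) \<chi> then 1 else 0) * (of_nat (card G))\<^sup>2 *
      (\<Prod>i<n. of_real ((cmod (L $$ (i, 0)))\<^sup>2))"
proof -
  define p where "p = (\<Prod>i<n. L $$ (i, 0))"
  define s where "s = (\<Sum>h\<in>G. \<chi> h)"
  have perm: "permute_list h (replicate n k) = replicate n k" if "h \<in> G" for h and k :: nat
    using G_permutes[OF that] permutes_in_image[OF G_permutes[OF that]]
    by (intro nth_equalityI) (auto simp: permute_list_nth)
  have "x (replicate n k) = (if k = 0 then p else 0)" if "k < n" for k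
  proof (cases "k = 0")
    case False
    then have "L $$ (0, replicate n k ! 0) = 0" using lower[of 0 k] that by simp
    then show ?thesis using False \<open>n > 0\<close> by (auto simp: x_def)
  qed (simp add: x_def p_def)
  then have sym: "symmetrize x (replicate n k) = (if k = 0 then s * p else 0)" if "k < n" for k
    using that by (simp add: symmetrize_def perm s_def sum_distrib_right[symmetric])
  have s: "s = (if principal_character (perm_subgroup n G) \<chi> then of_nat (card G) else 0)"
  proof (cases "s = 0")
    case True
    have "s = of_nat (card G)" if "principal_character (perm_subgroup n G) \<chi>"
      using that by (simp add: s_def principal_character_def)
    then show ?thesis using True by auto
  next
    case False
    then have "\<forall>g\<in>G. \<chi> g = 1" using chi_sum_nonzero unfolding s_def by blast
    then show ?thesis by (simp add: s_def principal_character_def)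
  qed
  have "inj_on (replicate n :: nat \<Rightarrow> nat list) {..<n}"
    using \<open>n > 0\<close> by (auto simp: inj_on_def)
  then have "(\<Sum>\<gamma>\<in>replicate n ` {..<n}. symmetrize x \<gamma> * cnj (symmetrize x \<gamma>)) =
      (\<Sum>k<n. symmetrize x (replicate n k) * cnj (symmetrize x (replicate n k)))"
    by (simp add: sum.reindex)
  also have "\<dots> = (\<Sum>k<n. if k = 0 then s * p * cnj (s * p) else 0)"
    by (intro sum.cong) (auto simp: sym)
  also have "\<dots> = s * cnj s * (p * cnj p)"
    using \<open>n > 0\<close> by simp
  also have "p * cnj p = (\<Prod>i<n. of_real ((cmod (L $$ (i, 0)))\<^sup>2))"
    unfolding p_def by (simp only: complex_norm_square cnj_prod prod.distrib)
  finally show ?thesis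
    by (simp add: s power2_eq_square)
qed

text \<open>Membership in B depends only on the multiset of the sequence, so B is a union of orbits.
  The orbits outside \<open>Omega\<close> drop out by \<open>symmetrize_vanishes\<close>.\<close>

lemma symmetrize_norm_rest:
  fixes L :: "complex mat"
  assumes R: "\<And>\<gamma>. \<gamma> \<in> Gamma n \<Longrightarrow> stabilizer_coset_reps n G \<gamma> (R \<gamma>)"
  defines "x \<equiv> (\<lambda>\<gamma>. \<Prod>i<n. L $$ (i, \<gamma> ! i))"
    and "B \<equiv> {\<gamma>\<in>Gamma n. mset \<gamma> \<noteq> mset [0..<n] \<and> (\<forall>k<n. \<gamma> \<noteq> replicate n k)}"
  shows "(\<Sum>\<gamma>\<in>B. symmetrize x \<gamma> * cnj (symmetrize x \<gamma>)) =
    (\<Sum>\<gamma>\<in>Delta_bar_star n G \<chi>. \<Sum>g\<in>R \<gamma>.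
      of_real ((cmod (gen_mat_fun n G \<chi> (select_cols n L \<gamma> * perm_matrix n g)))\<^sup>2))"
proof -
  have inv: "permute_list g \<gamma> \<in> B" if g: "g \<in> G" and \<gamma>: "\<gamma> \<in> B" for g \<gamma>
  proof -
    have G: "\<gamma> \<in> Gamma n" and perm: "g permutes {..<length \<gamma>}"
      using \<gamma> G_permutes[OF g] length_Gamma by (auto simp: B_def)
    have "permute_list g \<gamma> \<noteq> replicate n k" if "k < n" for k
    proof
      assume "permute_list g \<gamma> = replicate n k"
      then have "mset \<gamma> = mset (replicate n k)" using mset_permute_list[OF perm] by simp
      then have "set \<gamma> = set (replicate n k)" by (rule mset_eq_setD)
      then have "\<gamma> = replicate n k"
        using length_Gamma[OF G] that by (intro replicate_eqI) auto
      then show False using \<gamma> that by (auto simp: B_def)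
    qed
    then show ?thesis
      using \<gamma> act_Gamma[OF g G] mset_permute_list[OF perm] by (simp add: B_def)
  qed
  have star: "Delta_bar_star n G \<chi> = {\<gamma> \<in> B \<inter> Delta n G. \<gamma> \<in> Omega n G \<chi>}"
    by (auto simp: Delta_bar_star_def Delta_bar_def B_def Delta_def)
  have RG: "g \<in> G" if "\<gamma> \<in> Gamma n" "g \<in> R \<gamma>" for \<gamma> g
    using R[OF that(1)] that(2) by (auto simp: stabilizer_coset_reps_def)
  have "(\<Sum>\<gamma>\<in>B. symmetrize x \<gamma> * cnj (symmetrize x \<gamma>)) =
      (\<Sum>\<gamma>\<in>B \<inter> Delta n G. \<Sum>g\<in>R \<gamma>.
        symmetrize x (permute_list g \<gamma>) * cnj (symmetrize x (permute_list g \<gamma>)))"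
    by (rule sum_over_orbits) (use inv R in \<open>auto simp: B_def\<close>)
  also have "\<dots> = (\<Sum>\<gamma>\<in>Delta_bar_star n G \<chi>. \<Sum>g\<in>R \<gamma>.
      symmetrize x (permute_list g \<gamma>) * cnj (symmetrize x (permute_list g \<gamma>)))"
    unfolding star
  proof (rule sum.mono_neutral_right)
    show "finite (B \<inter> Delta n G)"
      by (rule finite_subset[OF _ finite_Gamma]) (auto simp: B_def)
    show "\<forall>\<gamma>\<in>B \<inter> Delta n G - {\<gamma> \<in> B \<inter> Delta n G. \<gamma> \<in> Omega n G \<chi>}. (\<Sum>g\<in>R \<gamma>.
        symmetrize x (permute_list g \<gamma>) * cnj (symmetrize x (permute_list g \<gamma>))) = 0"
    proof (intro ballI sum.neutral)
      fix \<gamma> g assume "\<gamma> \<in> B \<inter> Delta n G - {\<gamma> \<in> B \<inter> Delta n G. \<gamma> \<in> Omega n G \<chi>}" "g \<in> R \<gamma>"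
      then have "\<gamma> \<in> Gamma n" "\<gamma> \<notin> Omega n G \<chi>" "g \<in> G" using RG by (auto simp: B_def)
      then show "symmetrize x (permute_list g \<gamma>) * cnj (symmetrize x (permute_list g \<gamma>)) = 0"
        by (simp add: symmetrize_vanishes)
    qed
  qed auto
  also have "\<dots> = (\<Sum>\<gamma>\<in>Delta_bar_star n G \<chi>. \<Sum>g\<in>R \<gamma>.
      of_real ((cmod (gen_mat_fun n G \<chi> (select_cols n L \<gamma> * perm_matrix n g)))\<^sup>2))"
    unfolding star
  proof (intro sum.cong refl)
    fix \<gamma> g assume "\<gamma> \<in> {\<gamma> \<in> B \<inter> Delta n G. \<gamma> \<in> Omega n G \<chi>}" "g \<in> R \<gamma>"
    then have \<gamma>: "\<gamma> \<in> Gamma n" and g: "g \<in> G" using RG by (auto simp: B_def)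
    show "symmetrize x (permute_list g \<gamma>) * cnj (symmetrize x (permute_list g \<gamma>)) =
      of_real ((cmod (gen_mat_fun n G \<chi> (select_cols n L \<gamma> * perm_matrix n g)))\<^sup>2)"
      unfolding complex_norm_square gen_mat_fun_select_cols[OF \<gamma> g] x_def ..
  qed
  finally show ?thesis .
qed

end

section \<open>The decomposition of the normalized generalized matrix function\<close>

theorem theorem3p2:
  fixes n :: nat and G :: "(nat \<Rightarrow> nat) set" and \<chi> :: "(nat \<Rightarrow> nat) \<Rightarrow> complex"
    and A L :: "complex mat" and S :: "nat list \<Rightarrow> (nat \<Rightarrow> nat) set"
  assumes "n \<ge> 2"
    and "subgroup G (perm_group n)"
    and "irreducible_character (perm_subgroup n G) \<chi>"
    and "positive_semidefinite n A"
    and "cholesky_decomposition n A L"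
    and "\<And>\<gamma>. \<gamma> \<in> Gamma n \<Longrightarrow> stabilizer_coset_reps n G \<gamma> (S \<gamma>)"
  shows "normalized_gen_mat_fun n G \<chi> A =
    det A
    + (if principal_character (perm_subgroup n G) \<chi> then 1 else 0)
        * of_nat (card G) * (\<Prod>i<n. of_real ((cmod (L $$ (i, 0)))\<^sup>2))
    + (\<Sum>\<gamma>\<in>Delta_bar_star n G \<chi>. 1 / of_nat (card G) *
        (\<Sum>g\<in>S \<gamma>. of_real ((cmod (gen_mat_fun n G \<chi> (select_cols n L \<gamma> * perm_matrix n g)))\<^sup>2)))"
proof -
  interpret irreducible_permutation_character n G \<chi>
    using assms(2,3) by (rule irreducible_permutation_character.intro)
  have L: "L \<in> carrier_mat n n" and A: "A = L * mat_adjoint L"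
    and lower: "\<And>i j. i < n \<Longrightarrow> j < n \<Longrightarrow> i < j \<Longrightarrow> L $$ (i, j) = 0"
    using assms(5) by (auto simp: cholesky_decomposition_def)
  define x where "x = (\<lambda>\<gamma>. \<Prod>i<n. L $$ (i, \<gamma> ! i))"
  define f where "f \<gamma> = symmetrize x \<gamma> * cnj (symmetrize x \<gamma>)" for \<gamma>
  let ?c = "of_nat (card G) :: complex"
  let ?P = "{\<gamma>\<in>Gamma n. mset \<gamma> = mset [0..<n]}" and ?C = "replicate n ` {..<n}"
    and ?B = "{\<gamma>\<in>Gamma n. mset \<gamma> \<noteq> mset [0..<n] \<and> (\<forall>k<n. \<gamma> \<noteq> replicate n k)}"
  have c: "?c \<noteq> 0" using card_G by simp
  \<comment> \<open>This is where n \<ge> 2 enters: a rearrangement has n distinct values and a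
    constant sequence one, so the classes are disjoint.\<close>
  have "mset (replicate n k) \<noteq> mset [0..<n]" for k
  proof
    assume "mset (replicate n k) = mset [0..<n]"
    then have "card (set (replicate n k)) = card (set [0..<n])"
      by (intro arg_cong[of _ _ card] mset_eq_setD)
    then show False using assms(1) by simp
  qed
  then have disj: "?P \<inter> ?C = {}" "(?P \<union> ?C) \<inter> ?B = {}"
    by blast+
  have "?C \<subseteq> Gamma n"
    by (rule image_subsetI) (simp add: Gamma_def set_replicate_conv_if)
  then have un: "Gamma n = (?P \<union> ?C) \<union> ?B" by blast
  have fin: "finite ?P" "finite ?C" "finite ?B"
    using finite_Gamma[of n] by (simp_all del: mset_upt)
  have split: "(\<Sum>\<gamma>\<in>Gamma n. f \<gamma>) = (\<Sum>\<gamma>\<in>?P. f \<gamma>) + (\<Sum>\<gamma>\<in>?C. f \<gamma>) + (\<Sum>\<gamma>\<in>?B. f \<gamma>)"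
    by (subst un) (simp only: sum.union_disjoint fin disj finite_UnI)
  have "det A = (\<Prod>i<n. L $$ (i, i)) * cnj (\<Prod>i<n. L $$ (i, i))"
    unfolding A using L lower by (rule det_gram_lower_triangular)
  then have P: "(\<Sum>\<gamma>\<in>?P. f \<gamma>) = ?c * det A"
    using symmetrize_norm_permutations[OF lower] by (simp add: f_def x_def)
  have C: "(\<Sum>\<gamma>\<in>?C. f \<gamma>) = (if principal_character (perm_subgroup n G) \<chi> then 1 else 0) * ?c\<^sup>2 *
      (\<Prod>i<n. of_real ((cmod (L $$ (i, 0)))\<^sup>2))"
    using symmetrize_norm_constant[OF _ lower] assms(1) by (simp add: f_def x_def)
  have B: "(\<Sum>\<gamma>\<in>?B. f \<gamma>) = (\<Sum>\<gamma>\<in>Delta_bar_star n G \<chi>. \<Sum>g\<in>S \<gamma>.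
      of_real ((cmod (gen_mat_fun n G \<chi> (select_cols n L \<gamma> * perm_matrix n g)))\<^sup>2))"
    unfolding f_def x_def by (rule symmetrize_norm_rest[OF assms(6)])
  have "(\<Sum>\<gamma>\<in>Gamma n. f \<gamma>) = ?c / \<chi> id * gen_mat_fun n G \<chi> A"
    unfolding A gen_mat_fun_gram[OF L] f_def x_def by (rule symmetrize_norm)
  then have "normalized_gen_mat_fun n G \<chi> A = 1 / ?c * (\<Sum>\<gamma>\<in>Gamma n. f \<gamma>)"
    using c by (simp add: normalized_gen_mat_fun_def)
  \<comment> \<open>Division by |G| reduces |G| to 1 in the determinant term and |G|^2 to |G| in the
    constant term; the remaining sum keeps its 1/|G|.\<close>
  also have "\<dots> = det A
    + (if principal_character (perm_subgroup n G) \<chi> then 1 else 0)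
        * ?c * (\<Prod>i<n. of_real ((cmod (L $$ (i, 0)))\<^sup>2)) + 1 / ?c * (\<Sum>\<gamma>\<in>?B. f \<gamma>)"
    unfolding split P C using c by (simp add: field_simps power2_eq_square)
  finally show ?thesis
    unfolding B sum_distrib_left[of "1 / ?c", symmetric] .
qed

end
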